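(* Let $q$ be a prime power, let $R\ge 4$ and $t\ge 2$ be integers, and let $r=tR$. Put $m_1=\lceil\log_q (R+1)\rceil+1$. Then \[ \ell_q(r,R)=s_q(r-1,R-1)\le Rq^{(r-R)/R}+q^{(r-2R)/R}+\Delta_q(r,R), \] where the bound holds in each of the following cases with the indicated value of $\Delta_q(r,R)$: (i) $\Delta_q(r,R)=0$ if $t=2$ and ($q=4$ or $q\ge 7$), $R\ge 4$; (ii) $\Delta_q(r,R)=0$ if $t=2$, $q=5$, $R\in\{4,5\}$; (iii) $\Delta_q(r,R)=0$ if $t\ge\lceil\log_q R\rceil+3$, $q\ge 7$ odd, $R\ge4$; (iv) $\Delta_q(r,R)=\sum_{j=2}^{t}q^{(r-jR)/R}$ if $m_1+2<t<3m_1+2$, $q\ge 8$ even, $R\ge 4$; (v) $\Delta_q(r,R)=\sum_{j=2}^{m_1+2}q^{(r-jR)/R}$ if ($t=m_1+2$ or $t\ge 3m_1+2$), $q\ge 8$ even, $R\ge 4$.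
   Context: A $q$-ary linear $[n,n-r]_q$ code is a subspace of $\mathbb{F}_q^n$ of dimension $n-r$, given by an $r\times n$ parity check matrix $H$. Its covering radius is the least integer $R$ such that every column of $\mathbb{F}_q^r$ is a linear combination of at most $R$ columns of $H$. The length function $\ell_q(r,R)$ is the smallest length of a $q$-ary linear code of codimension $r$ and covering radius $R$. In the projective space $\mathrm{PG}(N,q)$ (points given by homogeneous coordinate vectors), a point set $S$ is $\rho$-saturating if every point of $\mathrm{PG}(N,q)$ is a linear combination of at most $\rho+1$ points of $S$, and $\rho$ is the smallest value with this property; $s_q(N,\rho)$ denotes the smallest size of a $\rho$-saturating set in $\mathrm{PG}(N,q)$. *)

theory Defs
  imports Complex_Main "Jordan_Normal_Form.Matrix_Kernel"
begin

text \<open>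
  Throughout, the field of order \<open>q\<close> is a type \<open>'a\<close> of class field and finite with
  \<open>card (UNIV :: 'a set) = q\<close>; its cardinality is automatically a prime power.
\<close>

abbreviation vspan :: "nat \<Rightarrow> ('a::field) vec set \<Rightarrow> 'a vec set" where
  "vspan n B \<equiv> LinearCombinations.module.span class_ring (module_vec TYPE('a) n) B"

definition linear_code :: "nat \<Rightarrow> nat \<Rightarrow> ('a::{field,finite}) vec set \<Rightarrow> bool" where
  "linear_code n k C \<longleftrightarrow>
     VectorSpace.subspace class_ring C (module_vec TYPE('a) n) \<and>
     vectorspace.dim class_ring ((module_vec TYPE('a) n)\<lparr>carrier := C\<rparr>) = k"

definition parity_check_matrix ::
  "nat \<Rightarrow> nat \<Rightarrow> ('a::{field,finite}) mat \<Rightarrow> 'a vec set \<Rightarrow> bool" where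
  "parity_check_matrix r n H C \<longleftrightarrow> H \<in> carrier_mat r n \<and> C = mat_kernel H"

text \<open>
  The covering radius is read off a parity check matrix. If \<open>H\<close> has a row count equal to the
  codimension of the code, then \<open>H\<close> has full row rank, so the minimum exists, and it does
  not depend on the choice of \<open>H\<close>.
\<close>

definition covering_radius :: "('a::{field,finite}) mat \<Rightarrow> nat" where
  "covering_radius H =
     (LEAST R. \<forall>v \<in> carrier_vec (dim_row H).
        \<exists>B \<subseteq> set (cols H). card B \<le> R \<and> v \<in> vspan (dim_row H) B)"

text \<open>The inequality \<open>r \<le> n\<close> keeps the dimension \<open>n - r\<close> from being truncated.\<close>

definition length_function :: "'a::{field,finite} itself \<Rightarrow> nat \<Rightarrow> nat \<Rightarrow> nat" where
  "length_function _ r R =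
     (LEAST n. r \<le> n \<and>
        (\<exists>(C :: 'a vec set) H. linear_code n (n - r) C \<and> parity_check_matrix r n H C \<and>
           covering_radius H = R))"

text \<open>
  A point of \<open>PG(N,q)\<close> is the set of all its homogeneous coordinate vectors, which have
  \<open>N + 1\<close> entries.
\<close>

definition proj_point :: "('a::{field,finite}) vec \<Rightarrow> 'a vec set" where
  "proj_point v = {c \<cdot>\<^sub>v v | c. c \<noteq> 0}"

definition proj_space :: "nat \<Rightarrow> ('a::{field,finite}) vec set set" where
  "proj_space N = {proj_point v | v. v \<in> carrier_vec (N + 1) \<and> v \<noteq> 0\<^sub>v (N + 1)}"

text \<open>
  Whether a point is a linear combination of the points in \<open>T\<close> does not depend on the choice
  of coordinate vectors, so all coordinate vectors are used at once.
\<close>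

definition combinations_cover :: "nat \<Rightarrow> nat \<Rightarrow> ('a::{field,finite}) vec set set \<Rightarrow> bool" where
  "combinations_cover N k S \<longleftrightarrow>
     (\<forall>P \<in> proj_space N. \<exists>T \<subseteq> S. card T \<le> k \<and> P \<subseteq> vspan (N + 1) (\<Union>T))"

definition saturating :: "nat \<Rightarrow> nat \<Rightarrow> ('a::{field,finite}) vec set set \<Rightarrow> bool" where
  "saturating N \<rho> S \<longleftrightarrow>
     S \<subseteq> proj_space N \<and> combinations_cover N (\<rho> + 1) S \<and>
     (\<forall>\<rho>' < \<rho>. \<not> combinations_cover N (\<rho>' + 1) S)"

definition min_saturating_size :: "'a::{field,finite} itself \<Rightarrow> nat \<Rightarrow> nat \<Rightarrow> nat" where
  "min_saturating_size _ N \<rho> =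
     (LEAST n. \<exists>S :: 'a vec set set. saturating N \<rho> S \<and> card S = n)"

end

theory Submission
  imports Defs "HOL-Algebra.Algebraic_Closure_Type" "HOL-Number_Theory.Residues"
begin

text \<open>
  In a space with basis \<open>U\<^sub>i, T\<^sub>i\<close> (\<open>i < R\<close>) take the points \<open>U\<^sub>i + t T\<^sub>i + f(t) T\<^sub>i\<^sub>+\<^sub>1\<close> for \<open>t\<close> in the
  field, where \<open>T\<^sub>R = 0\<close>, and the point \<open>T\<^sub>0\<close>. A vector is represented block by block. If its
  \<open>U\<^sub>i\<close>-coordinate is not 0, one point with suitable \<open>t\<close> clears the coordinates at \<open>U\<^sub>i\<close> and \<open>T\<^sub>i\<close>.
  Two points clear them even if the \<open>U\<^sub>i\<close>-coordinate is 0, and they leave a choice of the contribution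
  to \<open>T\<^sub>i\<^sub>+\<^sub>1\<close>, which can be used to clear the next block if its \<open>U\<close>-coordinate is 0. For
  \<open>f(t) = t\<^sup>2\<close> it follows that every vector is a combination of at most \<open>R\<close> of the \<open>Rq + 1\<close> points,
  which is the bound for \<open>t = 2\<close>.

  For \<open>q \<ge> 7\<close> there is an \<open>f\<close>, whose graph is contained in two (or three, for \<open>q = 7\<close>) parallel lines, for
  which every vector is a combination of exactly \<open>R\<close> points with nonzero coefficients. Then
  replace every column \<open>h\<close> by the columns \<open>(h, x, \<beta>x, \<dots>, \<beta>\<^sup>R\<^sup>-\<^sup>1x)\<close>, where \<open>x\<close> runs through the
  field of order \<open>q\<^sup>m\<close> with \<open>m = t - 2\<close> and \<open>\<beta>\<close> is an element of this field (or infinity) that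
  depends injectively on \<open>h\<close>. The new coordinates can be prescribed because Vandermonde systems
  are solvable, and the covering radius is still at most \<open>R\<close> with \<open>q\<^sup>m (Rq + 1)\<close> columns. So the
  bound holds with \<open>\<Delta> = 0\<close> in all cases.

  A code with covering radius at most \<open>R \<le> r\<close> can be deformed into one of the same length with
  covering radius exactly \<open>R\<close>.
\<close>

no_notation fps_nth (infixl \<open>$\<close> 75)
no_notation var (\<open>X\<index>\<close>)

section \<open>Representing a vector block by block\<close>

text \<open>
  A vector is a list of pairs \<open>(u\<^sub>i, \<tau>\<^sub>i)\<close>, one for each block. In \<open>op n u \<tau> \<sigma>\<close>, exactly \<open>n\<close> points
  of a block combine to \<open>(u, \<tau>)\<close> and at the same time contribute \<open>\<sigma>\<close> to the second coordinate
  of the next block, which \<open>lower \<sigma>\<close> therefore subtracts from what is still to be represented.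
\<close>

fun lower :: "'a::ab_group_add \<Rightarrow> ('a \<times> 'a) list \<Rightarrow> ('a \<times> 'a) list" where
  "lower \<sigma> [] = []"
| "lower \<sigma> ((u, \<tau>) # w) = (u, \<tau> - \<sigma>) # w"

lemma length_lower [simp]: "length (lower \<sigma> w) = length w"
  by (cases "(\<sigma>, w)" rule: lower.cases) auto

lemma lower_0 [simp]: "lower 0 w = w"
  by (cases "(0 :: 'a, w)" rule: lower.cases) auto

inductive chain :: "(nat \<Rightarrow> 'a \<Rightarrow> 'a \<Rightarrow> 'a \<Rightarrow> bool) \<Rightarrow> nat \<Rightarrow> ('a::ab_group_add \<times> 'a) list \<Rightarrow> bool"
  for op where
  Nil: "chain op 0 []"
| Cons: "op n u \<tau> \<sigma> \<Longrightarrow> chain op b (lower \<sigma> w) \<Longrightarrow> chain op (n + b) ((u, \<tau>) # w)"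

text \<open>The run consists of the leading blocks with \<open>u = 0\<close>. Such blocks are
  cleared in pairs, so an odd run leaves one that must be cleared from the left, by a preceding
  block or by \<open>T\<^sub>0\<close>.\<close>

fun even_run :: "('a::zero \<times> 'a) list \<Rightarrow> bool" where
  "even_run [] = True"
| "even_run ((u, \<tau>) # w) = (u = 0 \<longrightarrow> \<not> even_run w)"

lemma even_run_lower [simp]: "even_run (lower \<sigma> w) = even_run w"
  by (cases "(\<sigma>, w)" rule: lower.cases) auto

lemma odd_runE:
  assumes "\<not> even_run w"
  obtains \<tau> w' where "w = (0, \<tau>) # w'" "even_run w'"
  using assms by (cases w rule: even_run.cases) (auto split: if_splits)

lemma chain_Cons':
  "op n u \<tau> \<sigma> \<Longrightarrow> chain op b (lower \<sigma> w) \<Longrightarrow> c = n + b \<Longrightarrow> chain op c ((u, \<tau>) # w)"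
  by (simp add: chain.Cons)

lemma chain_zero: "op 0 0 0 0 \<Longrightarrow> chain op b w \<Longrightarrow> chain op b ((0, 0) # w)"
  by (rule chain_Cons'[of op 0 _ _ 0 b]) auto

text \<open>
  A block with \<open>u = 0\<close> cannot be handled with exactly one point. Hence such blocks are handled in
  pairs, or together with a preceding block with \<open>u \<noteq> 0\<close>: the first member of the pair takes two
  points and clears the second one. The surplus \<open>d\<close> is what a pair of zero blocks leaves to the
  blocks after it; only if there is no such block the claim fails.
\<close>

lemma chain_exact:
  fixes op :: "nat \<Rightarrow> 'a::ab_group_add \<Rightarrow> 'a \<Rightarrow> 'a \<Rightarrow> bool"
  assumes op0: "op 0 0 0 0"
    and op1: "\<And>u \<tau>. u \<noteq> 0 \<Longrightarrow> \<exists>\<sigma>. op 1 u \<tau> \<sigma>"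
    and op2: "\<And>u \<tau> \<sigma>. u \<noteq> 0 \<or> \<tau> \<noteq> 0 \<Longrightarrow> op 2 u \<tau> \<sigma>"
    and op3: "\<And>n u \<tau> \<sigma>. 3 \<le> n \<Longrightarrow> n \<le> 6 \<Longrightarrow> op n u \<tau> \<sigma>"
    and "even_run w" "d \<le> 2" "d = 0 \<longrightarrow> w \<noteq> [(0, 0), (0, 0)]" "d \<noteq> 0 \<longrightarrow> w \<noteq> []"
  shows "chain op (length w + d) w"
  using assms(5-)
proof (induction w arbitrary: d rule: length_induct)
  case (1 w)
  define E :: "('a \<times> 'a) list" where "E = [(0, 0), (0, 0)]"
  have IH: "chain op (length v + e) v"
    if "length v < length w" "even_run v" "e \<le> 2" "e = 0 \<Longrightarrow> v \<noteq> E" "e \<noteq> 0 \<Longrightarrow> v \<noteq> []" for v e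
    using 1 that unfolding E_def by blast
  have E: "chain op 0 E"
    unfolding E_def by (intro chain_zero op0 chain.Nil)
  show ?case
  proof (cases w)
    case Nil
    with 1 show ?thesis by (auto intro: chain.Nil)
  next
    case w: (Cons p v)
    obtain u \<tau> where p: "p = (u, \<tau>)" by force
    show ?thesis
    proof (cases "u = 0")
      case False
      show ?thesis
      proof (cases "even_run v")
        case True
        show ?thesis
        proof (cases "\<exists>\<sigma>. lower \<sigma> v = E")
          case True
          \<comment> \<open>As \<open>E\<close> cannot be given exactly two points by the induction
            hypothesis, it takes none here, and the first block takes all \<open>3 + d\<close>
            points.\<close>
          then obtain \<sigma> where \<sigma>: "lower \<sigma> v = E" by blast
          then have "length v = 2" unfolding E_def by (metis length_lower length_Cons list.size(3) numeral_2_eq_2)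
          then show ?thesis unfolding w p
            using chain_Cons'[of op "3 + d" u \<tau> \<sigma> 0 v] op3[of "3 + d"] E \<sigma> 1 by simp
        next
          case no: False
          obtain \<sigma> where \<sigma>: "op (1 + d) u \<tau> \<sigma>"
            using op1[of u \<tau>] op2[of u \<tau>] op3[of 3 u \<tau>] False \<open>d \<le> 2\<close>
            by (cases "d = 0"; cases "d = 1"; cases "d = 2") (auto simp: numeral_2_eq_2 numeral_3_eq_3)
          show ?thesis unfolding w p
            by (rule chain_Cons'[of op "1 + d" u \<tau> \<sigma>], rule \<sigma>, rule IH[of _ 0]) (use True no w in auto)
        qed
      next
        case odd: False
        then obtain \<tau>' v' where v: "v = (0, \<tau>') # v'" "even_run v'" by (rule odd_runE)
        show ?thesis
        proof (cases "v' = E")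
          case True
          \<comment> \<open>The first block takes the points of all four blocks. With a surplus of
            at most 2 this is where the limit 6 in \<open>op3\<close> comes from.\<close>
          have "chain op 0 (lower \<tau>' v)" unfolding v True
            by (simp, rule chain_Cons'[of op 0 _ _ 0 0], rule op0) (use E in auto)
          then show ?thesis unfolding w p
            by (intro chain_Cons'[where op = op and n = "4 + d" and u = u and \<sigma> = \<tau>' and b = 0]) (use True v op3 \<open>d \<le> 2\<close> in \<open>auto simp: E_def\<close>)
        next
          case no: False
          have "chain op (length v') (lower \<tau>' v)" unfolding v 
            by (simp, rule chain_Cons'[of op 0 _ _ 0 "length v' + 0"], rule op0, simp, rule IH[where e = 0, simplified]) (use no v w in auto)
          moreover have "op (2 + d) u \<tau> \<tau>'" using op2 op3[of "2+d"] False \<open>d \<le> 2\<close> by (cases "d = 0") auto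
          ultimately show ?thesis unfolding w p
            by (intro chain_Cons'[of op "2 + d" u]) (auto simp: v)
        qed
      qed
    next
      case u: True
      then have "\<not> even_run v" using 1 w p by auto
      then obtain \<tau>' v' where v: "v = (0, \<tau>') # v'" "even_run v'" by (rule odd_runE)
      note zero = chain_zero[of op, OF op0]
      \<comment> \<open>The first of two zero blocks can clear the second if there is a surplus or
        \<open>\<tau> \<noteq> 0\<close>. Otherwise the second takes two points by itself, or, if it
        is zero too, both points are passed on as surplus.\<close>
      consider "v' = E" | "v' \<noteq> E" "d \<noteq> 0 \<or> \<tau> \<noteq> 0" | "v' \<noteq> E" "d = 0" "\<tau> = 0" "\<tau>' \<noteq> 0"
        | "v' \<noteq> E" "d = 0" "\<tau> = 0" "\<tau>' = 0" by blast
      then show ?thesis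
      proof cases
        case 1
        show ?thesis unfolding w p
          by (rule chain_Cons'[of op "4 + d" u \<tau> \<tau>' 0])
             (use op3 \<open>d \<le> 2\<close> E zero v 1 in \<open>auto simp: E_def\<close>)
      next
        case 2
        have "op (2 + d) u \<tau> \<tau>'" using op2 op3[of "2+d"] 2 \<open>d \<le> 2\<close> by (cases "d = 0") auto
        moreover have "chain op (length v') v'" by (rule IH[where e = 0, simplified]) (use 2 v w in auto)
        ultimately show ?thesis unfolding w p
          by (intro chain_Cons'[of op "2 + d" u \<tau> \<tau>' "length v'"]) (use v zero in auto)
      next
        case 3
        have "chain op (length v') v'" by (rule IH[where e = 0, simplified]) (use 3 v w in auto)
        then have "chain op (2 + length v') ((0, \<tau>') # v')"
          by (intro chain_Cons'[of op 2 0 \<tau>' 0]) (use op2 3 in auto)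
        then show ?thesis unfolding w p u 3 v using zero by auto
      next
        case 4
        then have "v' \<noteq> []" using 1(4) w p u v E_def "1.prems" by auto
        then have "chain op (length v' + 2) v'" by (intro IH) (use 4 v w in auto)
        then show ?thesis unfolding w p u 4 v using zero by (auto simp: numeral_2_eq_2)
      qed
    qed
  qed
qed

text \<open>\<open>e\<close> is the coefficient of \<open>T\<^sub>0\<close>, which clears the first
  block of an odd run. If this block is already zero, the rest gets the point as surplus instead.
  Length at least 4 keeps the exceptional lists of \<open>chain_exact\<close> away.\<close>

corollary chain_exact_top:
  fixes op :: "nat \<Rightarrow> 'a::ab_group_add \<Rightarrow> 'a \<Rightarrow> 'a \<Rightarrow> bool"
  assumes op0: "op 0 0 0 0"
    and op1: "\<And>u \<tau>. u \<noteq> 0 \<Longrightarrow> \<exists>\<sigma>. op 1 u \<tau> \<sigma>"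
    and op2: "\<And>u \<tau> \<sigma>. u \<noteq> 0 \<or> \<tau> \<noteq> 0 \<Longrightarrow> op 2 u \<tau> \<sigma>"
    and op3: "\<And>n u \<tau> \<sigma>. 3 \<le> n \<Longrightarrow> n \<le> 6 \<Longrightarrow> op n u \<tau> \<sigma>"
    and len: "length w \<ge> 4"
  shows "chain op (length w) w \<or> (\<exists>e. e \<noteq> 0 \<and> chain op (length w - 1) (lower e w))"
proof (cases "even_run w")
  case True
  then have "chain op (length w + 0) w" by (intro chain_exact[of op, OF op0 op1 op2 op3]) (use len in auto)
  then show ?thesis by simp
next
  case False
  then obtain \<tau> v where w: "w = (0, \<tau>) # v" "even_run v" by (rule odd_runE)
  note zero = chain_zero[of op, OF op0]
  show ?thesis
  proof (cases "\<tau> = 0")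
    case True
    have "chain op (length v + 1) v" by (intro chain_exact[of op, OF op0 op1 op2 op3]) (use len w in auto)
    then show ?thesis using zero True w by auto
  next
    case False
    have "chain op (length v + 0) v" by (intro chain_exact[of op, OF op0 op1 op2 op3]) (use len w in auto)
    then show ?thesis using zero False w by (intro disjI2 exI[of _ \<tau>]) auto
  qed
qed

section \<open>Representations with at most a given number of points\<close>

definition cover :: "(nat \<Rightarrow> 'a \<Rightarrow> 'a \<Rightarrow> 'a \<Rightarrow> bool) \<Rightarrow> nat \<Rightarrow> ('a::ab_group_add \<times> 'a) list \<Rightarrow> bool" where
  "cover op c w \<longleftrightarrow> (\<exists>b\<le>c. chain op b w)"

lemma cover_Nil: "cover op c []"
  unfolding cover_def using chain.Nil by blast

lemma cover_Cons:
  "\<exists>n\<le>k. op n u \<tau> \<sigma> \<Longrightarrow> cover op b (lower \<sigma> w) \<Longrightarrow> k + b \<le> c \<Longrightarrow> cover op c ((u, \<tau>) # w)"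
  unfolding cover_def by (meson add_le_mono chain.Cons le_trans)

lemma cover_mono: "cover op b w \<Longrightarrow> b \<le> c \<Longrightarrow> cover op c w"
  unfolding cover_def using le_trans by blast

text \<open>
  For the parabola in characteristic 2 two points cannot combine to \<open>u = 0\<close>, \<open>\<tau> \<noteq> 0\<close>, \<open>\<sigma> = 0\<close>,
  because all its chords have nonzero slope. So a pair \<open>(0, \<tau>), (0, 0)\<close> costs a third point, but
  two such pairs in succession need only four points. Hence only the parity of the number of
  leading pairs of this kind matters.
\<close>

fun bad_start :: "('a::zero \<times> 'a) list \<Rightarrow> bool" where
  "bad_start ((u, \<tau>) # (u', \<tau>') # w) = (u = 0 \<and> \<tau> \<noteq> 0 \<and> u' = 0 \<and> \<tau>' = 0 \<and> \<not> bad_start w)"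
| "bad_start _ = False"

lemma bad_startE:
  assumes "bad_start w"
  obtains \<tau> w' where "w = (0, \<tau>) # (0, 0) # w'" "\<tau> \<noteq> 0" "\<not> bad_start w'"
  using assms by (cases w rule: bad_start.cases) auto

text \<open>The pairing of \<open>chain_exact\<close> without exactness. As \<open>op2'\<close> only
  allows \<open>\<sigma> \<noteq> 0\<close>, what a block passes on is chosen so that the rest has
  no bad start or so that the bad start is cleared.\<close>

lemma chain_cover:
  fixes op :: "nat \<Rightarrow> 'a::ab_group_add \<Rightarrow> 'a \<Rightarrow> 'a \<Rightarrow> bool"
  assumes op0: "op 0 0 0 0"
    and op1: "\<And>u \<tau>. u \<noteq> 0 \<Longrightarrow> \<exists>\<sigma>. op 1 u \<tau> \<sigma>"
    and op2: "\<And>u \<tau> \<sigma>. u \<noteq> 0 \<Longrightarrow> \<exists>n\<le>2. op n u \<tau> \<sigma>"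
    and op2': "\<And>\<tau> \<sigma>. \<tau> \<noteq> 0 \<Longrightarrow> \<sigma> \<noteq> 0 \<Longrightarrow> op 2 0 \<tau> \<sigma>"
    and op3: "\<And>\<tau> \<sigma>. \<tau> \<noteq> 0 \<Longrightarrow> \<exists>n\<le>3. op n 0 \<tau> \<sigma>"
    and third: "\<And>x :: 'a. \<exists>y. y \<noteq> 0 \<and> y \<noteq> x"
    and "even_run w"
  shows "cover op (length w + (if bad_start w then 1 else 0)) w"
  using assms(7)
proof (induction w rule: length_induct)
  case (1 w)
  have IH: "cover op c v"
    if "length v < length w" "even_run v" "length v + (if bad_start v then 1 else 0) \<le> c" for v c
    using 1 that cover_mono by blast
  have zero: "cover op c ((0, 0) # v)" if "cover op c v" for c v
    by (rule cover_Cons[of 0 op 0 0 0 c]) (use op0 that in auto)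
  have two: "cover op c ((0, \<tau>) # v)" if "\<tau> \<noteq> 0" "\<sigma> \<noteq> 0" "cover op b (lower \<sigma> v)" "2 + b \<le> c" for c \<tau> \<sigma> b v
    by (rule cover_Cons[of 2 op 0 \<tau> \<sigma> b]) (use op2' that in auto)
  have three: "cover op c ((0, \<tau>) # v)" if "\<tau> \<noteq> 0" "cover op b (lower \<sigma> v)" "3 + b \<le> c" for c \<tau> \<sigma> b v
    by (rule cover_Cons[of 3 op 0 \<tau> \<sigma> b]) (use op3 that in auto)
  show ?case
  proof (cases w)
    case Nil
    then show ?thesis by (simp add: cover_Nil)
  next
    case w: (Cons p v)
    obtain u \<tau> where p: "p = (u, \<tau>)" by force
    show ?thesis
    proof (cases "u = 0")
      case u: False
      then have nb: "\<not> bad_start w" using w p by (cases v) auto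
      obtain \<sigma> where \<sigma>: "op 1 u \<tau> \<sigma>" using op1 u by blast
      have one: "cover op c w" if "cover op b (lower \<sigma> v)" "1 + b \<le> c" for c b
        unfolding w p by (rule cover_Cons[of 1 op u \<tau> \<sigma> b]) (use \<sigma> that in auto)
      have pair: "cover op c w" if "cover op b (lower \<sigma> v)" "2 + b \<le> c" for c b \<sigma>
        unfolding w p by (rule cover_Cons[of 2 op u \<tau> \<sigma> b]) (use op2 u that in auto)
      show ?thesis
      proof (cases "even_run v")
        case even: True
        show ?thesis
        proof (cases "bad_start (lower \<sigma> v)")
          case True
          \<comment> \<open>The forced contribution of a single point would create a bad start. Two
            points clear the head of the rest instead, and the zero block after it is free.\<close>
          then obtain \<tau>' x where x: "lower \<sigma> v = (0, \<tau>') # (0, 0) # x" "\<not> bad_start x"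
            by (rule bad_startE)
          then obtain \<tau>'' where v: "v = (0, \<tau>'') # (0, 0) # x" by (cases v) auto
          have "cover op (length v - 2) x" by (rule IH) (use v w x even in auto)
          then have "cover op (length v - 2) (lower \<tau>'' v)" unfolding v using zero by auto
          then show ?thesis using pair[of "length v - 2" \<tau>'' "length w"] nb v w by simp
        next
          case False
          have "cover op (length v) (lower \<sigma> v)" by (rule IH) (use False w even in auto)
          then show ?thesis using one nb w by auto
        qed
      next
        case odd: False
        then obtain \<tau>' v' where v: "v = (0, \<tau>') # v'" "even_run v'" by (rule odd_runE)
        show ?thesis
        proof (cases "bad_start v'")
          case bad: True
          then obtain \<rho> x where x: "v' = (0, \<rho>) # (0, 0) # x" "\<rho> \<noteq> 0" "\<not> bad_start x"
            by (rule bad_startE)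
          show ?thesis
          \<comment> \<open>Either the single point happens to clear the head of \<open>v\<close>,
            which pays for the bad start of \<open>v'\<close>, or the head keeps a nonzero second
            coordinate and its two points can clear \<open>\<rho>\<close>.\<close>
          proof (cases "\<tau>' = \<sigma>")
            case True
            have "cover op (length v) v'" by (rule IH) (use v w in auto)
            then show ?thesis using one[of "length v"] nb v w zero True by auto
          next
            case False
            have "cover op (length v - 3) x" by (rule IH) (use v w x in auto)
            then have "cover op (length v - 1) (lower \<sigma> v)"
              unfolding v x lower.simps
              by (intro two[where \<sigma> = \<rho> and b = "length x"]) (use False x zero in auto)
            then show ?thesis using one[of "length v - 1"] nb w by auto
          qed
        next
          case False
          have "cover op (length v') v'" by (rule IH) (use False v w in auto)
          then have "cover op (length v') (lower \<tau>' v)" unfolding v by (auto intro: zero)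
          then show ?thesis using pair[of "length v'" \<tau>' "length w"] nb v w by simp
        qed
      qed
    next
      case u: True
      then have "\<not> even_run v" using 1 w p by auto
      then obtain \<tau>' x where v: "v = (0, \<tau>') # x" "even_run x" by (rule odd_runE)
      have x0: "cover op (length x) x" if "\<not> bad_start x"
        by (rule IH) (use v w that in auto)
      have x1: "cover op (length x + 1) x" 
        by (rule IH) (use v w in auto)
      note eq = w p u v(1)
      show ?thesis
      proof (cases "\<tau> = 0")
        case \<tau>: True
        show ?thesis
        proof (cases "\<tau>' = 0")
          case True
          have "cover op (length x + 1) w" unfolding eq \<tau> True by (intro zero x1)
          then show ?thesis by (rule cover_mono) (simp add: eq)
        next
          case \<tau>': False
          have nb: "\<not> bad_start w" unfolding eq \<tau> by simp
          \<comment> \<open>A nonzero \<sigma> may create a bad start only if \<open>x\<close> has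
            the second form. Then three points can pass on \<open>\<rho>\<close>, even 0; they are
            affordable because two blocks of \<open>x\<close> become free.\<close>
          consider "\<exists>\<sigma>. \<sigma> \<noteq> 0 \<and> \<not> bad_start (lower \<sigma> x)" | \<rho> y where "x = (0, \<rho>) # (0, 0) # y"
          proof -
            obtain \<sigma> :: 'a where \<sigma>: "\<sigma> \<noteq> 0" using third by blast
            show thesis
            proof (cases "bad_start (lower \<sigma> x)")
              case True
              then obtain \<rho> y where "lower \<sigma> x = (0, \<rho>) # (0, 0) # y" by (rule bad_startE)
              then show thesis using that(2) by (cases x) auto
            qed (use \<sigma> that in blast)
          qed
          then have "cover op (length x + 2) v"
          proof cases
            case 1
            then obtain \<sigma> where \<sigma>: "\<sigma> \<noteq> 0" "\<not> bad_start (lower \<sigma> x)" by blast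
            have "cover op (length x) (lower \<sigma> x)" by (rule IH) (use \<sigma> v w in auto)
            then show ?thesis unfolding v by (rule two[rotated 2]) (use \<sigma> \<tau>' in auto)
          next
            case 2
            have "cover op (length y + 1) y" by (rule IH) (use 2 v w in auto)
            then have "cover op (length y + 1) (lower \<rho> x)" unfolding 2 by (auto intro: zero)
            then show ?thesis unfolding v by (rule three[rotated]) (use 2 \<tau>' in auto)
          qed
          then show ?thesis using nb unfolding eq \<tau> by (auto intro: zero)
        qed
      next
        case \<tau>: False
        show ?thesis
        proof (cases "\<tau>' = 0")
          case \<tau>': True
          have bad: "bad_start w \<longleftrightarrow> \<not> bad_start x" unfolding eq \<tau>' using \<tau> by simp
          show ?thesis
          proof (cases "bad_start x")
            case True
            then obtain \<rho> y where y: "x = (0, \<rho>) # (0, 0) # y" "\<rho> \<noteq> 0" "\<not> bad_start y"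
              by (rule bad_startE)
            obtain \<sigma> :: 'a where \<sigma>: "\<sigma> \<noteq> 0" using third by blast
            have "cover op (length y) y" by (rule IH) (use y v w in auto)
            then have "cover op (length y + 2) ((0, 0 - \<sigma>) # x)"
              unfolding y by (intro two[where \<sigma> = \<rho> and b = "length y"]) (use \<sigma> y zero in auto)
            then show ?thesis unfolding eq \<tau>'
              by (intro two[where \<sigma> = \<sigma> and b = "length y + 2"]) (use \<sigma> \<tau> y in auto)
          next
            case False
            have "cover op (length x) (lower 0 v)" unfolding v \<tau>' using zero x0 False by auto
            then show ?thesis using bad False unfolding w p u
              by (intro three[where \<sigma> = 0 and b = "length x"]) (use \<tau> v in auto)
          qed
        next
          case \<tau>': False
          then have nb: "\<not> bad_start w" unfolding eq by simp
          show ?thesis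
          proof (cases "bad_start x")
            case True
            then obtain \<rho> y where y: "x = (0, \<rho>) # (0, 0) # y" "\<rho> \<noteq> 0" "\<not> bad_start y"
              by (rule bad_startE)
            \<comment> \<open>The second block is deliberately not cleared: its own two points then
              clear \<open>\<rho>\<close>, and four points serve four blocks.\<close>
            obtain \<sigma> where \<sigma>: "\<sigma> \<noteq> 0" "\<sigma> \<noteq> \<tau>'" using third by blast
            have "cover op (length y) y" by (rule IH) (use y v w in auto)
            then have "cover op (length y + 2) (lower \<sigma> v)"
              unfolding v y lower.simps by (intro two[where \<sigma> = \<rho> and b = "length y"]) (use \<sigma> y zero in auto)
            then show ?thesis unfolding w p u
              by (intro two[where \<sigma> = \<sigma> and b = "length y + 2"]) (use \<sigma> \<tau> y v in auto)
          next
            case False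
            have "cover op (length x) (lower \<tau>' v)" unfolding v using zero x0 False by auto
            then show ?thesis using nb unfolding w p u
              by (intro two[where \<sigma> = \<tau>' and b = "length x"]) (use \<tau> \<tau>' v in auto)
          qed
        qed
      qed
    qed
  qed
qed

text \<open>\<open>T\<^sub>0\<close> with coefficient \<open>e\<close> clears the first block of an
  odd run or of a bad start. An odd run followed by a bad start manages without it: its first block
  is free, or its two points clear the next block.\<close>

corollary chain_cover_top:
  fixes op :: "nat \<Rightarrow> 'a::ab_group_add \<Rightarrow> 'a \<Rightarrow> 'a \<Rightarrow> bool"
  assumes op0: "op 0 0 0 0"
    and op1: "\<And>u \<tau>. u \<noteq> 0 \<Longrightarrow> \<exists>\<sigma>. op 1 u \<tau> \<sigma>"
    and op2: "\<And>u \<tau> \<sigma>. u \<noteq> 0 \<Longrightarrow> \<exists>n\<le>2. op n u \<tau> \<sigma>"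
    and op2': "\<And>\<tau> \<sigma>. \<tau> \<noteq> 0 \<Longrightarrow> \<sigma> \<noteq> 0 \<Longrightarrow> op 2 0 \<tau> \<sigma>"
    and op3: "\<And>\<tau> \<sigma>. \<tau> \<noteq> 0 \<Longrightarrow> \<exists>n\<le>3. op n 0 \<tau> \<sigma>"
    and third: "\<And>x :: 'a. \<exists>y. y \<noteq> 0 \<and> y \<noteq> x"
  shows "cover op (length w) w \<or> (\<exists>e b. b + 1 \<le> length w \<and> chain op b (lower e w))"
proof -
  have main: "cover op (length w + (if bad_start w then 1 else 0)) w" if "even_run w" for w
    by (rule chain_cover) (fact op0 op1 op2 op2' op3 third that)+
  have zero: "cover op c ((0, 0) # v)" if "cover op c v" for c v
    by (rule cover_Cons[of 0 op 0 0 0 c]) (use op0 that in auto)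
  have T: "cover op b (lower e w) \<Longrightarrow> b + 1 \<le> length w \<Longrightarrow> ?thesis" for b e
    unfolding cover_def by (meson add_le_mono1 le_trans)
  show ?thesis
  proof (cases "even_run w")
    case True
    show ?thesis
    proof (cases "bad_start w")
      case bad: True
      then obtain \<rho> y where y: "w = (0, \<rho>) # (0, 0) # y" "\<rho> \<noteq> 0" "\<not> bad_start y"
        by (rule bad_startE)
      then have "cover op (length y) y" using main[of y] True by simp
      then show ?thesis by (intro T[of "length y" \<rho>]) (auto simp: y zero)
    next
      case False
      then show ?thesis using main[OF True] by simp
    qed
  next
    case False
    then obtain \<tau> v where w: "w = (0, \<tau>) # v" "even_run v" by (rule odd_runE)
    show ?thesis
    proof (cases "bad_start v")
      case bad: True
      then obtain \<rho> y where y: "v = (0, \<rho>) # (0, 0) # y" "\<rho> \<noteq> 0" "\<not> bad_start y"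
        by (rule bad_startE)
      show ?thesis
      proof (cases "\<tau> = 0")
        case True
        then show ?thesis using zero main[OF w(2)] bad w by auto
      next
        case False
        have "cover op (length y) (lower \<rho> v)" using main[of y] y w zero by auto
        then have "cover op (length y + 2) w" unfolding w
          by (intro cover_Cons[of 2 op 0 \<tau> \<rho> "length y"]) (use op2' False y in auto)
        then show ?thesis using w y cover_mono[of op "length y + 2" w "length w"] by auto
      qed
    next
      case False
      then have "cover op (length v) (lower \<tau> w)" using main[OF w(2)] zero w by auto
      then show ?thesis using w by (intro T[of "length v" \<tau>]) auto
    qed
  qed
qed

section \<open>Combinations of points on the graph of a function\<close>

text \<open>\<open>block\<close> without its third equation. Where \<open>f\<close> is constant on
  \<open>X\<close>, that equation follows from the first one.\<close>

definition part :: "'a::field set \<Rightarrow> nat \<Rightarrow> 'a \<Rightarrow> 'a \<Rightarrow> bool" where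
  "part X n \<alpha> \<tau> \<longleftrightarrow> (\<exists>A c. A \<subseteq> X \<and> finite A \<and> card A = n \<and> (\<forall>t\<in>A. c t \<noteq> 0) \<and>
     (\<Sum>t\<in>A. c t) = \<alpha> \<and> (\<Sum>t\<in>A. c t * t) = \<tau>)"

text \<open>The instance of \<open>op\<close> for the actual points: \<open>u\<close>,
  \<open>\<tau>\<close>, \<open>\<sigma>\<close> are the coordinates at \<open>U\<^sub>i\<close>,
  \<open>T\<^sub>i\<close>, \<open>T\<^sub>i\<^sub>+\<^sub>1\<close>.\<close>

definition block :: "('a::field \<Rightarrow> 'a) \<Rightarrow> nat \<Rightarrow> 'a \<Rightarrow> 'a \<Rightarrow> 'a \<Rightarrow> bool" where
  "block f n u \<tau> \<sigma> \<longleftrightarrow> (\<exists>A c. finite A \<and> card A = n \<and> (\<forall>t\<in>A. c t \<noteq> 0) \<and>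
     (\<Sum>t\<in>A. c t) = u \<and> (\<Sum>t\<in>A. c t * t) = \<tau> \<and> (\<Sum>t\<in>A. c t * f t) = \<sigma>)"

lemma block_0: "block f 0 0 0 0"
  unfolding block_def by (rule exI[of _ "{}"]) simp

lemma block_1: "u \<noteq> 0 \<Longrightarrow> block f 1 u (u * t) (u * f t)"
  unfolding block_def by (rule exI[of _ "{t}"], rule exI[of _ "\<lambda>_. u"]) simp

lemma block_2:
  assumes "t \<noteq> s" "a \<noteq> 0" "b \<noteq> 0"
  shows "block f 2 (a + b) (a * t + b * s) (a * f t + b * f s)"
  unfolding block_def
  by (rule exI[of _ "{t, s}"], rule exI[of _ "\<lambda>x. if x = t then a else b"]) (use assms in auto)

lemma block_3:
  assumes "distinct [t, s, r]" "a \<noteq> 0" "b \<noteq> 0" "c \<noteq> 0"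
  shows "block f 3 (a + b + c) (a * t + b * s + c * r) (a * f t + b * f s + c * f r)"
  unfolding block_def
  by (rule exI[of _ "{t, s, r}"], rule exI[of _ "\<lambda>x. if x = t then a else if x = s then b else c"])
    (use assms in \<open>auto simp: algebra_simps\<close>)

lemma part_0: "part X 0 0 0"
  unfolding part_def by (rule exI[of _ "{}"]) simp

lemma part_1: "t \<in> X \<Longrightarrow> a \<noteq> 0 \<Longrightarrow> part X 1 a (a * t)"
  unfolding part_def by (rule exI[of _ "{t}"], rule exI[of _ "\<lambda>_. a"]) simp

text \<open>On \<open>A \<union> B\<close> the function is the indicator of \<open>B\<close>, so the
  contribution to the next block is the sum of the coefficients on \<open>B\<close>. The two lines
  can be treated separately.\<close>

lemma block_part:
  assumes "part A k \<alpha> \<tau>" "part B l \<beta> \<tau>'"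
    and f: "\<And>t. t \<in> A \<Longrightarrow> f t = 0" "\<And>t. t \<in> B \<Longrightarrow> f t = 1"
  shows "block f (k + l) (\<alpha> + \<beta>) (\<tau> + \<tau>') \<beta>"
proof -
  obtain S c where S: "S \<subseteq> A" "finite S" "card S = k" "\<forall>t\<in>S. c t \<noteq> 0"
     "(\<Sum>t\<in>S. c t) = \<alpha>" "(\<Sum>t\<in>S. c t * t) = \<tau>" using assms unfolding part_def by blast
  obtain S' c' where S': "S' \<subseteq> B" "finite S'" "card S' = l" "\<forall>t\<in>S'. c' t \<noteq> 0"
     "(\<Sum>t\<in>S'. c' t) = \<beta>" "(\<Sum>t\<in>S'. c' t * t) = \<tau>'" using assms unfolding part_def by blast
  define e where "e = (\<lambda>t. if t \<in> A then c t else c' t)"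
  have AB: "A \<inter> B = {}" using f by fastforce
  then have dis: "S \<inter> S' = {}" using S S' by blast
  have e: "e t = c t" "f t = 0" if "t \<in> S" for t using that S f unfolding e_def by auto
  have e': "e t = c' t" "f t = 1" if "t \<in> S'" for t using that S' f AB unfolding e_def by auto
  have 1: "(\<Sum>t\<in>S. g t (e t)) = (\<Sum>t\<in>S. g t (c t))" "(\<Sum>t\<in>S'. g t (e t)) = (\<Sum>t\<in>S'. g t (c' t))" for g :: "'a \<Rightarrow> 'a \<Rightarrow> 'a"
    using e e' by auto
  have 2: "(\<Sum>t\<in>S. e t * f t) = 0" "(\<Sum>t\<in>S'. e t * f t) = \<beta>"
    using e(2) e' S'(5) by simp_all
  show ?thesis unfolding block_def
    by (rule exI[of _ "S \<union> S'"], rule exI[of _ e])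
      (use S S' dis e e' 2 1[of "\<lambda>_ x. x"] 1[of "\<lambda>t x. x * t"] in \<open>auto simp: card_Un_disjoint sum.union_disjoint\<close>)
qed

text \<open>Cramer's rule. A coefficient vanishes only if \<open>(\<alpha>, \<tau>)\<close> is a
  multiple of the other point, \<open>(1, s)\<close> or \<open>(1, t)\<close>.\<close>

lemma part_2:
  assumes "t \<in> X" "s \<in> X" "t \<noteq> s" "\<tau> \<noteq> \<alpha> * t" "\<tau> \<noteq> \<alpha> * s"
  shows "part X 2 \<alpha> \<tau>"
proof -
  define a where "a = (\<tau> - \<alpha> * s) / (t - s)"
  define b where "b = (\<alpha> * t - \<tau>) / (t - s)"
  have ab: "a * (t - s) = \<tau> - \<alpha> * s" "b * (t - s) = \<alpha> * t - \<tau>"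
    unfolding a_def b_def using assms(3) by simp_all
  have "(a + b - \<alpha>) * (t - s) = 0" using ab by Groebner_Basis.algebra
  moreover have "(a * t + b * s - \<tau>) * (t - s) = 0" using ab by Groebner_Basis.algebra
  ultimately have "a + b - \<alpha> = 0" "a * t + b * s - \<tau> = 0" using assms(3) by simp_all
  then have "a + b = \<alpha>" "a * t + b * s = \<tau>" by (simp_all only: right_minus_eq)
  moreover have "a \<noteq> 0" "b \<noteq> 0" using assms unfolding a_def b_def by auto
  ultimately show ?thesis unfolding part_def
    by (intro exI[of _ "{t, s}"] exI[of _ "\<lambda>x. if x = t then a else b"]) (use assms in auto)
qed

section \<open>Two or three points of a line\<close>

lemma exists_avoiding:
  assumes "finite S" "card S < card (UNIV :: 'a::finite set)"
  shows "\<exists>x :: 'a. x \<notin> S"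
proof (rule ccontr)
  assume "\<not> ?thesis"
  then have "S = UNIV" by auto
  with assms show False by simp
qed

locale three_points =
  fixes X :: "'a::{field,finite} set" and x y z :: 'a
  assumes X: "x \<in> X" "y \<in> X" "z \<in> X" and distinct: "x \<noteq> y" "x \<noteq> z" "y \<noteq> z"
    and large: "card (UNIV :: 'a set) \<ge> 7"
begin

text \<open>At most one of the three parameters violates the conditions of \<open>part_2\<close>, so
  the other two can be used.\<close>

lemma pair: "\<alpha> \<noteq> 0 \<or> \<tau> \<noteq> 0 \<Longrightarrow> part X 2 \<alpha> \<tau>"
  using part_2[of x X y \<tau> \<alpha>] part_2[of x X z \<tau> \<alpha>] part_2[of y X z \<tau> \<alpha>] X distinct by force

lemma triple: "part X 3 \<alpha> \<tau>"
proof -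
  \<comment> \<open>The coefficient \<open>c\<close> at \<open>z\<close> is free. The coefficient at
    \<open>y\<close> vanishes for \<open>c = p\<close> and the one at \<open>x\<close> for
    \<open>c = q\<close>.\<close>
  define p where "p = (\<tau> - \<alpha> * x) / (z - x)"
  define q where "q = (\<tau> - \<alpha> * y) / (z - y)"
  have "card {0, p, q} \<le> 3" by (simp add: card_insert_if)
  then obtain c where c: "c \<notin> {0, p, q}" using exists_avoiding[of "{0,p,q}"] large by auto
  define a where "a = (\<tau> - c * z - (\<alpha> - c) * y) / (x - y)"
  define b where "b = ((\<alpha> - c) * x - (\<tau> - c * z)) / (x - y)"
  have eqs: "p * (z - x) = \<tau> - \<alpha> * x" "q * (z - y) = \<tau> - \<alpha> * y"
    "a * (x - y) = \<tau> - c * z - (\<alpha> - c) * y" "b * (x - y) = (\<alpha> - c) * x - (\<tau> - c * z)"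
    unfolding p_def q_def a_def b_def using distinct by simp_all
  have "a * (x - y) = (q - c) * (z - y)" using eqs by Groebner_Basis.algebra
  moreover have "b * (x - y) = (c - p) * (z - x)" using eqs by Groebner_Basis.algebra
  moreover have "(a + b + c - \<alpha>) * (x - y) = 0" using eqs by Groebner_Basis.algebra
  moreover have "(a * x + b * y + c * z - \<tau>) * (x - y) = 0" using eqs by Groebner_Basis.algebra
  ultimately have "a \<noteq> 0" "b \<noteq> 0" "a + b + c - \<alpha> = 0" "a * x + b * y + c * z - \<tau> = 0"
    using c distinct by auto
  then have "a \<noteq> 0" "b \<noteq> 0" "a + b + c = \<alpha>" "a * x + b * y + c * z = \<tau>"
    by (simp_all only: right_minus_eq not_False_eq_True)
  then show ?thesis unfolding part_def
    by (intro exI[of _ "{x, y, z}"] exI[of _ "\<lambda>t. if t = x then a else if t = y then b else c"])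
      (use c X distinct in \<open>auto simp: algebra_simps\<close>)
qed

end

text \<open>The points are distributed over the lines as 3 + 0, 0 + 3, 1 + 2, 2 + 2, 3 + 2 or 3 + 3,
  and the second line gets the coefficient sum \<open>\<sigma>\<close>. Three points of a line reach
  every pair of sums, two every nonzero pair.\<close>

lemma block_large:
  fixes f :: "'a::{field,finite} \<Rightarrow> 'a"
  assumes "three_points A x y z" "three_points B x' y' z'"
    and f: "\<And>t. t \<in> A \<Longrightarrow> f t = 0" "\<And>t. t \<in> B \<Longrightarrow> f t = 1" and n: "3 \<le> n" "n \<le> 6"
  shows "block f n u \<tau> \<sigma>"
proof -
  interpret A: three_points A x y z by fact
  interpret B: three_points B x' y' z' by fact
  note bp = block_part[of A _ _ _ B _ _ _ f, OF _ _ f]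
  \<comment> \<open>For the distribution 2 + 2, \<tau> is split into two nonzero summands, so that
    neither line has to represent \<open>(0, 0)\<close>.\<close>
  have "card {0, \<tau>} \<le> 2" by (simp add: card_insert_if)
  then obtain \<tau>' where \<tau>': "\<tau>' \<noteq> 0" "\<tau>' \<noteq> \<tau>" using exists_avoiding[of "{0, \<tau>}"] A.large by auto
  consider "n = 3" "\<sigma> = 0" | "n = 3" "\<sigma> = u" | "n = 3" "\<sigma> \<noteq> 0" "\<sigma> \<noteq> u" | "n = 4" | "n = 5" | "n = 6"
    using n by linarith
  then show ?thesis
  proof cases
    case 1 then show ?thesis using bp[OF A.triple[of u \<tau>] part_0] by simp
  next
    case 2 then show ?thesis using bp[OF part_0 B.triple[of u \<tau>]] by simp
  next
    case 3 then show ?thesis using bp[OF part_1[OF A.X(1), of "u - \<sigma>"] B.pair[of \<sigma> "\<tau> - (u - \<sigma>) * x"]]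
      by (simp add: numeral_3_eq_3 numeral_2_eq_2)
  next
    case 4 then show ?thesis using bp[OF A.pair[of "\<tau> - \<tau>'" "u - \<sigma>"] B.pair[of \<sigma> \<tau>']] bp[OF A.pair[of "u - \<sigma>" "\<tau> - \<tau>'"] B.pair[of \<sigma> \<tau>']] \<tau>' by simp
  next
    case 5 then show ?thesis using bp[OF A.triple[of "u - \<sigma>" "\<tau> - 1"] B.pair[of \<sigma> 1]] by simp
  next
    case 6 then show ?thesis using bp[OF A.triple[of "u - \<sigma>" 0] B.triple[of \<sigma> \<tau>]] by simp
  qed
qed

text \<open>
  The points of the graph of the indicator function of \<open>-A\<close> lie on two parallel lines. A point off
  these lines is on no chord of the graph iff the projection of one line to the other from that
  point is an affine map that preserves \<open>A\<close>.
\<close>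

lemma affine_not_preserved:
  fixes c \<kappa> \<mu> :: "'a::field"
  assumes c: "c \<noteq> 0" "c \<noteq> 1" "c \<noteq> 2" "c \<noteq> -1" "2 * c \<noteq> 1" "c * c - c + 1 \<noteq> 0"
    and "\<kappa> \<noteq> 0" "\<kappa> \<noteq> 1 \<or> \<mu> \<noteq> 0"
  shows "\<exists>t \<in> {0, 1, c}. \<kappa> * t + \<mu> \<notin> {0, 1, c}"
proof (rule ccontr)
  assume "\<not> ?thesis"
  then have *: "\<mu> \<in> {0, 1, c}" "\<kappa> + \<mu> \<in> {0, 1, c}" "\<kappa> * c + \<mu> \<in> {0, 1, c}" by auto
  have c1: "c + 1 \<noteq> 0" "2 * c - 1 \<noteq> 0" "c - 2 \<noteq> 0" "c - 1 \<noteq> 0"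
    using c by (auto simp: eq_neg_iff_add_eq_0)
  have third: "\<kappa> * c + \<mu> = 0 \<or> \<kappa> * c + \<mu> = 1 \<or> \<kappa> * c + \<mu> = c" using * by blast
  \<comment> \<open>An injective affine map is determined by the images of 0 and 1. Besides the
    identity there are five candidates, and for each of them the image of \<open>c\<close>
    contradicts the choice of \<open>c\<close>.\<close>
  have no1: False if a: "\<mu> = 0" "\<kappa> = c"
  proof -
    have "c * c = 0 \<or> (c - 1) * (c + 1) = 0 \<or> c * (c - 1) = 0"
      using third unfolding a by (elim disjE) (simp_all add: algebra_simps)
    then show False using c c1 by auto
  qed
  have no2: False if a: "\<mu> = 1" "\<kappa> = -1"
  proof -
    have "(c - 1) = 0 \<or> c = 0 \<or> (2 * c - 1) = 0"
      using third unfolding a by (elim disjE) (simp_all add: algebra_simps)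
    then show False using c c1 by auto
  qed
  have no3: False if a: "\<mu> = 1" "\<kappa> = c - 1"
  proof -
    have "(c * c - c + 1) = 0 \<or> c * (c - 1) = 0 \<or> (c - 1) * (c - 1) = 0"
      using third unfolding a by (elim disjE) (simp_all add: algebra_simps)
    then show False using c c1 by auto
  qed
  have no4: False if a: "\<mu> = c" "\<kappa> = - c"
  proof -
    have "c * (c - 1) = 0 \<or> (c * c - c + 1) = 0 \<or> c * c = 0"
      using third unfolding a by (elim disjE) (simp_all add: algebra_simps)
    then show False using c c1 by auto
  qed
  have no5: False if a: "\<mu> = c" "\<kappa> = 1 - c"
  proof -
    have "c * (c - 2) = 0 \<or> (c - 1) * (c - 1) = 0 \<or> c * (c - 1) = 0"
      using third unfolding a by (elim disjE) (simp_all add: algebra_simps)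
    then show False using c c1 by auto
  qed
  have "\<mu> = 0 \<or> \<mu> = 1 \<or> \<mu> = c" "\<kappa> = - \<mu> \<or> \<kappa> = 1 - \<mu> \<or> \<kappa> = c - \<mu>"
    using * by (auto simp: algebra_simps eq_neg_iff_add_eq_0)
  then show False using assms(7,8) no1 no2 no3 no4 no5 by auto
qed

section \<open>Fields with at least eight elements\<close>

lemma exists_generic_point:
  assumes "card (UNIV :: 'a::{field,finite} set) \<ge> 8"
  obtains c :: "'a::{field,finite}" where "c \<noteq> 0" "c \<noteq> 1" "c \<noteq> 2" "c \<noteq> -1" "2 * c \<noteq> 1" "c * c - c + 1 \<noteq> 0"
proof -
  \<comment> \<open>At most seven elements are excluded: \<open>2 * x = 1\<close> has at most the
    solution \<open>h\<close>, and \<open>x * x - x + 1 = 0\<close> at most \<open>r\<close> and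
    \<open>1 - r\<close>. If there is no solution, the choice is arbitrary.\<close>
  define h where "h = (SOME h :: 'a. 2 * h = 1)"
  define r where "r = (SOME r :: 'a. r * r - r + 1 = 0)"
  have "card {0, 1, 2, -1, h, r, 1 - r} \<le> 7" using card_length[of "[0, 1, 2, -1, h, r, 1 - r]"] by simp
  then obtain c where c: "c \<notin> {0, 1, 2, -1, h, r, 1 - r}"
    using exists_avoiding[of "{0, 1, 2, -1, h, r, 1 - r}"] assms by fastforce
  have "2 * c \<noteq> 1"
  proof
    assume *: "2 * c = 1"
    then have "2 * h = 1" unfolding h_def by (rule someI)
    with * have "c = h" by (metis mult_left_cancel mult_zero_left zero_neq_one)
    with c show False by simp
  qed
  moreover have "c * c - c + 1 \<noteq> 0"
  proof
    assume *: "c * c - c + 1 = 0"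
    then have "r * r - r + 1 = 0" unfolding r_def by (rule someI)
    with * have "(c - r) * (c + r - 1) = 0" by Groebner_Basis.algebra
    then have "c = r \<or> c = 1 - r" by (auto simp: eq_diff_eq)
    with c show False by blast
  qed
  ultimately show thesis using c that by auto
qed

lemma card_ge_3E:
  assumes "card X \<ge> 3"
  obtains x y z where "x \<in> X" "y \<in> X" "z \<in> X" "x \<noteq> y" "x \<noteq> z" "y \<noteq> z"
proof -
  obtain Y where "Y \<subseteq> X" "card Y = 3" using assms by (meson obtain_subset_with_card_n)
  then show thesis using that unfolding card_3_iff by auto
qed

lemma block_function_large:
  assumes large: "card (UNIV :: 'a::{field,finite} set) \<ge> 8"
  obtains f :: "'a::{field,finite} \<Rightarrow> 'a" where "\<And>u \<tau> \<sigma>. u \<noteq> 0 \<or> \<tau> \<noteq> 0 \<Longrightarrow> block f 2 u \<tau> \<sigma>"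
    and "\<And>n u \<tau> \<sigma>. 3 \<le> n \<Longrightarrow> n \<le> 6 \<Longrightarrow> block f n u \<tau> \<sigma>"
proof -
  obtain c :: 'a where c: "c \<noteq> 0" "c \<noteq> 1" "c \<noteq> 2" "c \<noteq> -1" "2 * c \<noteq> 1" "c * c - c + 1 \<noteq> 0"
    using exists_generic_point[OF large] by metis
  define A where "A = {0, 1, c}"
  define f where "f = (\<lambda>t. if t \<in> A then 0 else 1 :: 'a)"
  have "card (-A) \<ge> 3" using large c unfolding A_def by (subst card_Diff_subset[of _ UNIV, folded Compl_eq_Diff_UNIV]) (simp_all add: card_insert_if)
  then obtain x y z where xyz: "x \<in> -A" "y \<in> -A" "z \<in> -A" "x \<noteq> y" "x \<noteq> z" "y \<noteq> z" by (rule card_ge_3E)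
  interpret A: three_points A 0 1 c
    by unfold_locales (use large c in \<open>auto simp: A_def\<close>)
  interpret B: three_points "-A" x y z
    by unfold_locales (use large xyz in auto)
  have f: "t \<in> A \<Longrightarrow> f t = 0" "t \<in> - A \<Longrightarrow> f t = 1" for t unfolding f_def by auto
  note bp = block_part[of A _ _ _ "-A" _ _ _ f, OF _ _ f]
  show thesis
  proof (rule that)
    fix n :: nat and u \<tau> \<sigma> :: 'a assume "3 \<le> n" "n \<le> 6"
    then show "block f n u \<tau> \<sigma>" by (intro block_large[OF A.three_points_axioms B.three_points_axioms]) (auto simp: f)
  next
    fix u \<tau> \<sigma> :: 'a assume u: "u \<noteq> 0 \<or> \<tau> \<noteq> 0"
    consider "\<sigma> = 0" | "\<sigma> = u" | "\<sigma> \<noteq> 0" "\<sigma> \<noteq> u" by blast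
    then show "block f 2 u \<tau> \<sigma>"
    proof cases
      case 1 then show ?thesis using bp[OF A.pair[of u \<tau>] part_0] u by simp
    next
      case 2 then show ?thesis using bp[OF part_0 B.pair[of u \<tau>]] u by (simp add: numeral_2_eq_2)
    next
      case 3
      \<comment> \<open>One point at \<open>t\<close> in \<open>A\<close> gets the coefficient
        \<open>u - \<sigma>\<close>, one on the other line gets \<open>\<sigma>\<close>. The
        equation for \<tau> then forces the parameter \<open>\<kappa> * t + \<mu>\<close> on the
        other line.\<close>
      define \<kappa> where "\<kappa> = 1 - u / \<sigma>"
      define \<mu> where "\<mu> = \<tau> / \<sigma>"
      have "\<kappa> \<noteq> 0" "\<kappa> \<noteq> 1 \<or> \<mu> \<noteq> 0" using 3 u unfolding \<kappa>_def \<mu>_def by auto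
      then obtain t where t: "t \<in> A" "\<kappa> * t + \<mu> \<notin> A"
        using affine_not_preserved[OF c, of \<kappa> \<mu>] unfolding A_def by blast
      have "(u - \<sigma>) * t + \<sigma> * (\<kappa> * t + \<mu>) = \<tau>"
        using 3 unfolding \<kappa>_def \<mu>_def by (simp add: field_simps)
      then show ?thesis
        using bp[OF part_1[OF t(1), of "u - \<sigma>"] part_1[of "\<kappa> * t + \<mu>" "-A" \<sigma>]] t 3
        by (simp add: numeral_2_eq_2)
    qed
  qed
qed

section \<open>The field with seven elements\<close>

lemma block_scale: "block f n u \<tau> \<sigma> \<Longrightarrow> k \<noteq> 0 \<Longrightarrow> block f n (k * u) (k * \<tau>) (k * \<sigma>)"
  unfolding block_def
  by (elim exE, rule_tac x = A in exI, rule_tac x = "\<lambda>t. k * c t" in exI)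
    (auto simp: sum_distrib_left mult.assoc)

text \<open>
  Every 3-element subset of the field of order 7 is preserved by a nontrivial affine map, so a
  third value is needed. The function was found by computer search.
\<close>

definition step7 :: "int \<Rightarrow> int" where
  "step7 k = (if k \<le> 2 then 0 else if k \<le> 5 then 1 else 2)"

text \<open>The case \<open>u = 1\<close> with coefficients \<open>a\<close> and
  \<open>1 - a\<close>; the range of \<open>a\<close> keeps both nonzero modulo 7.\<close>

lemma chords7:
  "\<forall>\<tau>\<in>set [0..6]. \<forall>\<sigma>\<in>set [0..6]. \<exists>t\<in>set [0..6]. \<exists>s\<in>set [0..6]. \<exists>a\<in>set [2..6].
     t \<noteq> s \<and> (a * t + (1 - a) * s) mod 7 = \<tau> \<and> (a * step7 t + (1 - a) * step7 s) mod 7 = \<sigma>"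
  by code_simp

text \<open>The case \<open>u = 0\<close>, \<open>\<tau> = 1\<close> with coefficients
  \<open>a\<close> and \<open>- a\<close>.\<close>

lemma slopes7:
  "\<forall>\<sigma>\<in>set [0..6]. \<exists>t\<in>set [0..6]. \<exists>s\<in>set [0..6]. \<exists>a\<in>set [1..6].
     t \<noteq> s \<and> (a * (t - s)) mod 7 = 1 \<and> (a * (step7 t - step7 s)) mod 7 = \<sigma>"
  by code_simp

text \<open>The field has characteristic 7 and consists of the images of 0 to 6, so computations
  with residues transfer. Scaling reduces two points to the cases of \<open>chords7\<close> and
  \<open>slopes7\<close>.\<close>

lemma block_function_7:
  assumes card: "card (UNIV :: 'a::{field,finite} set) = 7"
  obtains f :: "'a::{field,finite} \<Rightarrow> 'a" where "\<And>u \<tau> \<sigma>. u \<noteq> 0 \<or> \<tau> \<noteq> 0 \<Longrightarrow> block f 2 u \<tau> \<sigma>"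
    and "\<And>n u \<tau> \<sigma>. 3 \<le> n \<Longrightarrow> n \<le> 6 \<Longrightarrow> block f n u \<tau> \<sigma>"
proof -
  have "CHAR('a) dvd 7" using CHAR_dvd_CARD[where ?'a = 'a] card by simp
  moreover have "Factorial_Ring.prime (7 :: nat)" by simp
  ultimately have char: "CHAR('a) = 7" using prime_nat_iff[of 7] by auto
  have eq: "(of_int a :: 'a) = of_int b \<longleftrightarrow> a mod 7 = b mod 7" for a b
    using of_int_eq_iff_cong_CHAR[of a b, where ?'a = 'a] char by (simp add: cong_def)
  have inj: "inj_on (of_int :: int \<Rightarrow> 'a) {0..6}" by (rule inj_onI) (auto simp: eq)
  have "card (of_int ` {0..6} :: 'a set) = card (UNIV :: 'a set)" using card_image[OF inj] card by simp
  then have "of_int ` {0..6} = (UNIV :: 'a set)" by (intro card_subset_eq) auto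
  then have surj: "\<exists>k\<in>set [0..6]. x = of_int k" for x :: 'a by (metis (no_types) UNIV_I imageE set_upto)
  define f where "f = (\<lambda>x :: 'a. of_int (step7 (the_inv_into {0..6} of_int x)) :: 'a)"
  have f: "f (of_int k) = of_int (step7 k)" if "k \<in> set [0..6]" for k
    unfolding f_def using that by (subst the_inv_into_f_f[OF inj]) auto
  have A: "three_points (of_int ` {0, 1, 2} :: 'a set) (of_int 0) (of_int 1) (of_int 2)"
    and B: "three_points (of_int ` {3, 4, 5} :: 'a set) (of_int 3) (of_int 4) (of_int 5)"
    by (unfold_locales; (simp only: eq card)?; simp)+
  show thesis
  proof (rule that)
    fix n :: nat and u \<tau> \<sigma> :: 'a assume "3 \<le> n" "n \<le> 6"
    then show "block f n u \<tau> \<sigma>"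
      by (intro block_large[OF A B]) (auto simp: step7_def f[of 0, simplified] f[of 1, simplified]
         f[of 2, simplified] f[of 3, simplified] f[of 4, simplified] f[of 5, simplified])
  next
    fix u \<tau> \<sigma> :: 'a assume u: "u \<noteq> 0 \<or> \<tau> \<noteq> 0"
    show "block f 2 u \<tau> \<sigma>"
    proof (cases "u = 0")
      case False
      obtain \<tau>' \<sigma>' where *: "\<tau> / u = of_int \<tau>'" "\<sigma> / u = of_int \<sigma>'" "\<tau>' \<in> set [0..6]" "\<sigma>' \<in> set [0..6]"
        using surj by metis
      with chords7 obtain t s a where w: "t \<in> set [0..6]" "s \<in> set [0..6]" "a \<in> set [2..6]" "t \<noteq> s"
        "(a * t + (1 - a) * s) mod 7 = \<tau>'" "(a * step7 t + (1 - a) * step7 s) mod 7 = \<sigma>'" by metis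
      have a: "2 \<le> a" "a \<le> 6" using w by auto
      have "a mod 7 \<noteq> 0" using a by presburger
      moreover have "(1 - a) mod 7 \<noteq> 0" using a by presburger
      moreover have "t mod 7 \<noteq> s mod 7" using w by simp
      ultimately have "block f 2 (of_int a + of_int (1 - a)) (of_int a * of_int t + of_int (1 - a) * of_int s)
         (of_int a * f (of_int t) + of_int (1 - a) * f (of_int s))"
        by (intro block_2) (use eq[of t s] eq[of a 0] eq[of "1 - a" 0] in auto)
      also have "of_int a + of_int (1 - a) = (1 :: 'a)" by simp
      also have "of_int a * of_int t + of_int (1 - a) * of_int s = \<tau> / u"
        using eq[of "a * t + (1 - a) * s" \<tau>'] w *(1,3) by auto
      also have "of_int a * f (of_int t) + of_int (1 - a) * f (of_int s) = \<sigma> / u"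
        using eq[of "a * step7 t + (1 - a) * step7 s" \<sigma>'] w *(2,4) f by auto
      finally show ?thesis using block_scale[of f 2 1 "\<tau> / u" "\<sigma> / u" u] False by simp
    next
      case True
      with u have \<tau>: "\<tau> \<noteq> 0" by simp
      obtain \<sigma>' where *: "\<sigma> / \<tau> = of_int \<sigma>'" "\<sigma>' \<in> set [0..6]"
        using surj by metis
      with slopes7 obtain t s a where w: "t \<in> set [0..6]" "s \<in> set [0..6]" "a \<in> set [1..6]" "t \<noteq> s"
        "(a * (t - s)) mod 7 = 1" "(a * (step7 t - step7 s)) mod 7 = \<sigma>'" by metis
      have a: "1 \<le> a" "a \<le> 6" using w by auto
      have "a mod 7 \<noteq> 0" using a by presburger
      moreover have "(- a) mod 7 \<noteq> 0" using a by presburger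
      moreover have "t mod 7 \<noteq> s mod 7" using w by simp
      ultimately have "block f 2 (of_int a + of_int (- a)) (of_int a * of_int t + of_int (- a) * of_int s)
         (of_int a * f (of_int t) + of_int (- a) * f (of_int s))"
        by (intro block_2) (use eq[of t s] eq[of a 0] eq[of "- a" 0] in auto)
      also have "of_int a + of_int (- a) = (0 :: 'a)" by simp
      also have "of_int a * of_int t + of_int (- a) * of_int s = (1 :: 'a)"
        using eq[of "a * (t - s)" 1] w by (simp add: algebra_simps)
      also have "of_int a * f (of_int t) + of_int (- a) * f (of_int s) = \<sigma> / \<tau>"
        using eq[of "a * (step7 t - step7 s)" \<sigma>'] w * f by (simp add: algebra_simps)
      finally show ?thesis using block_scale[of f 2 0 1 "\<sigma> / \<tau>" \<tau>] \<tau> True by simp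
    qed
  qed
qed

section \<open>The parabola\<close>

text \<open>
  For \<open>x * y = c\<close> the chord of the parabola through the points at \<open>t + x\<close> and \<open>t + y\<close> passes through
  \<open>(t, t * t - c)\<close>.
\<close>

lemma block_square_2:
  fixes u \<tau> \<sigma> :: "'a::{field,finite}"
  assumes u: "u \<noteq> 0" and card: "card (UNIV :: 'a set) \<ge> 4"
  shows "\<exists>n\<le>2. block (\<lambda>t. t * t) n u \<tau> \<sigma>"
proof -
  define t where "t = \<tau> / u"
  define c where "c = t * t - \<sigma> / u"
  have \<tau>: "\<tau> = u * t" and \<sigma>: "\<sigma> = u * (t * t - c)" using u unfolding t_def c_def by simp_all
  show ?thesis
  proof (cases "c = 0")
    case True
    then show ?thesis using block_1[OF u, of "\<lambda>t. t * t" t] \<tau> \<sigma> by (intro exI[of _ 1]) auto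
  next
    case False
    \<comment> \<open>The chord needs two different parameters, so \<open>x\<close> avoids 0 and the
      square roots of \<open>c\<close>, of which there are at most two.\<close>
    define r where "r = (SOME x. x * x = c)"
    have "card {0, r, - r} \<le> 3" by (simp add: card_insert_if)
    then obtain x where x: "x \<notin> {0, r, - r}" using exists_avoiding[of "{0, r, - r}"] card by auto
    have "x * x \<noteq> c"
    proof
      assume *: "x * x = c"
      then have "r * r = c" unfolding r_def by (rule someI)
      with * have "x = r \<or> x = - r" by (metis square_eq_iff)
      with x show False by auto
    qed
    then have k: "c - x * x \<noteq> 0" by auto
    define y where "y = c / x"
    \<comment> \<open>The weights of the point over \<open>t\<close> on the chord are proportional
      to \<open>y\<close> and \<open>- x\<close>; \<open>k\<close> scales their sum to
      \<open>u\<close>.\<close>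
    define k where "k = u / (c - x * x)"
    have xy: "x * y = c" using x unfolding y_def by simp
    have ku: "k * (c - x * x) = u" using k unfolding k_def by simp
    have nz: "k \<noteq> 0" "x \<noteq> y" using u ku xy k by auto
    have "block (\<lambda>t. t * t) 2 (k * c + - (k * x * x)) (k * c * (t + x) + - (k * x * x) * (t + y))
      (k * c * ((t + x) * (t + x)) + - (k * x * x) * ((t + y) * (t + y)))"
      using nz x False by (intro block_2) auto
    also have "k * c + - (k * x * x) = u" using ku by (simp add: algebra_simps)
    also have "k * c * (t + x) + - (k * x * x) * (t + y) = \<tau>"
    proof -
      have "k * c * (t + x) + - (k * x * x) * (t + y) = k * (c - x * x) * t + k * x * (c - x * y)"
        by (simp add: algebra_simps)
      then show ?thesis unfolding \<tau> ku xy by simp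
    qed
    also have "k * c * ((t + x) * (t + x)) + - (k * x * x) * ((t + y) * (t + y)) = \<sigma>"
    proof -
      have "k * c * ((t + x) * (t + x)) + - (k * x * x) * ((t + y) * (t + y)) =
        k * (c - x * x) * (t * t - c) + 2 * k * x * (c - x * y) * t + k * (c * c - (x * y) * (x * y))"
        by (simp add: algebra_simps)
      then show ?thesis unfolding \<sigma> ku xy by simp
    qed
    finally show ?thesis by blast
  qed
qed

text \<open>The chord from the origin with slope \<sigma>/\<tau> meets the parabola again at this
  parameter, which is not 0.\<close>

lemma block_square_2':
  fixes \<tau> \<sigma> :: "'a::field"
  assumes "\<tau> \<noteq> 0" "\<sigma> \<noteq> 0"
  shows "block (\<lambda>t. t * t) 2 0 \<tau> \<sigma>"
  using block_2[of "\<sigma> / \<tau>" 0 "\<tau> * \<tau> / \<sigma>" "- (\<tau> * \<tau> / \<sigma>)" "\<lambda>t. t * t"] assms by simp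

lemma block_square_3:
  fixes \<tau> \<sigma> :: "'a::{field,finite}"
  assumes "\<tau> \<noteq> 0" and card: "card (UNIV :: 'a set) \<ge> 4"
  shows "\<exists>n\<le>3. block (\<lambda>t. t * t) n 0 \<tau> \<sigma>"
proof (cases "\<sigma> = 0")
  case True
  have "card {0, 1, - 1 :: 'a} \<le> 3" by (simp add: card_insert_if)
  \<comment> \<open>The combination of the points at 0, 1 and \<open>t\<close> below has the sums 0,
    \<open>c * (t - t * t)\<close> and 0. The choice of \<open>t\<close> makes its coefficients and
    the middle sum nonzero.\<close>
  then obtain t :: 'a where t: "t \<notin> {0, 1, - 1}" using exists_avoiding[of "{0, 1, - 1 :: 'a}"] card by auto
  have "(t - 1) * (t + 1) \<noteq> 0" "t * (1 - t) \<noteq> 0" using t by (auto simp: eq_neg_iff_add_eq_0)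
  then have n: "t * t - 1 \<noteq> 0" "t - t * t \<noteq> 0" by (simp_all add: algebra_simps)
  define c where "c = \<tau> / (t - t * t)"
  have c: "c * (t - t * t) = \<tau>" "c \<noteq> 0" using n assms unfolding c_def by auto
  have "block (\<lambda>t. t * t) 3 (c * (t * t - 1) + - (c * t * t) + c) (c * (t * t - 1) * 0 + - (c * t * t) * 1 + c * t)
     (c * (t * t - 1) * (0 * 0) + - (c * t * t) * (1 * 1) + c * (t * t))"
    using t c n by (intro block_3) auto
  then have "block (\<lambda>t. t * t) 3 0 \<tau> 0" using c(1) by (simp add: algebra_simps)
  then show ?thesis using True by auto
next
  case False
  then show ?thesis using block_square_2'[OF assms(1) False] by (intro exI[of _ 2]) auto
qed

section \<open>Finite extension fields\<close>

text \<open>Multiplication by a nonzero \<open>x\<close> permutes the nonzero elements and so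
  preserves their product.\<close>

lemma power_card_field:
  fixes x :: "'a::{field,finite}"
  shows "x ^ card (UNIV :: 'a set) = x"
proof (cases "x = 0")
  case True
  then show ?thesis by (simp add: finite_UNIV_card_ge_0)
next
  case False
  let ?P = "\<Prod>y \<in> UNIV - {0 :: 'a}. y"
  have "?P = (\<Prod>y \<in> UNIV - {0}. x * y)"
    by (rule prod.reindex_bij_witness[of _ "\<lambda>y. x * y" "\<lambda>y. y / x"]) (use False in auto)
  also have "\<dots> = x ^ (card (UNIV :: 'a set) - 1) * ?P"
    by (simp add: prod.distrib card_Diff_subset)
  finally have "x ^ (card (UNIV :: 'a set) - 1) = 1" by simp
  then have "x * x ^ (card (UNIV :: 'a set) - 1) = x" by simp
  then show ?thesis
    by (metis finite_UNIV_card_ge_0 finite_class.finite_UNIV power_eq_if not_gr_zero)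
qed

text \<open>The inner binomial terms of \<open>(X + 1)^q\<close> form a polynomial of degree below
  \<open>q\<close> that vanishes at all \<open>q\<close> elements, hence is 0. This avoids writing
  \<open>q\<close> as a prime power.\<close>

lemma choose_card_eq_0:
  assumes "0 < i" "i < card (UNIV :: 'a::{field,finite} set)"
  shows "of_nat (card (UNIV :: 'a set) choose i) = (0 :: 'a)"
proof -
  define q where "q = card (UNIV :: 'a set)"
  define p :: "'a poly" where "p = (\<Sum>i\<in>{1..<q}. Polynomial.monom (of_nat (q choose i)) i)"
  have q0: "q > 0" unfolding q_def by (simp add: finite_UNIV_card_ge_0)
  have "poly p x = 0" for x
  proof -
    have "x + 1 = (x + 1) ^ q" unfolding q_def by (rule power_card_field[symmetric])
    also have "\<dots> = (\<Sum>i\<le>q. of_nat (q choose i) * x ^ i)" by (simp add: binomial_ring)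
    also have "{..q} = insert 0 (insert q {1..<q})" using q0 by auto
    also have "(\<Sum>i\<in>insert 0 (insert q {1..<q}). of_nat (q choose i) * x ^ i) = 1 + (x ^ q + poly p x)"
      using q0 by (simp add: p_def poly_sum poly_monom)
    finally show ?thesis using power_card_field[of x] unfolding q_def by simp
  qed
  then have roots: "{x. poly p x = 0} = UNIV" by auto
  have deg: "Polynomial.degree p < q" unfolding p_def
    by (rule degree_sum_less) (use q0 in \<open>auto intro: le_less_trans[OF degree_monom_le]\<close>)
  have "p = 0"
  proof (rule ccontr)
    assume "p \<noteq> 0"
    then show False using card_poly_roots_bound[of p] roots deg unfolding q_def by simp
  qed
  then have "Polynomial.coeff p i = 0" by simp
  then show ?thesis using assms unfolding p_def coeff_sum q_def by (simp add: if_distrib sum.delta cong: if_cong)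
qed

lemma frobenius_add:
  fixes x y :: "'a::{field,finite} alg_closure"
  shows "(x + y) ^ (card (UNIV :: 'a set) ^ m) = x ^ (card (UNIV :: 'a set) ^ m) + y ^ (card (UNIV :: 'a set) ^ m)"
proof -
  define q where "q = card (UNIV :: 'a set)"
  have q0: "q > 0" unfolding q_def by (simp add: finite_UNIV_card_ge_0)
  have step: "(x + y) ^ q = x ^ q + y ^ q" for x y :: "'a alg_closure"
  proof -
    have "(of_nat (q choose i) :: 'a alg_closure) = 0" if "i \<in> {1..<q}" for i
      using arg_cong[OF choose_card_eq_0[of i, where ?'a = 'a], of to_ac] that unfolding q_def by simp
    then have "(\<Sum>i\<in>{1..<q}. of_nat (q choose i) * x ^ i * y ^ (q - i)) = 0" by simp
    moreover have "{..q} = insert 0 (insert q {1..<q})" using q0 by auto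
    ultimately show ?thesis unfolding binomial_ring using q0 by (simp add: add.commute)
  qed
  have "(x + y) ^ (q ^ m) = x ^ (q ^ m) + y ^ (q ^ m)"
  proof (induction m)
    case (Suc m)
    have "(x + y) ^ (q ^ Suc m) = ((x + y) ^ (q ^ m)) ^ q" by (simp add: power_mult[symmetric] mult.commute)
    also have "\<dots> = x ^ (q ^ Suc m) + y ^ (q ^ Suc m)"
      unfolding Suc step by (simp add: power_mult[symmetric] mult.commute)
    finally show ?case .
  qed simp
  then show ?thesis unfolding q_def .
qed

section \<open>The field of order \<open>q^m\<close> inside the algebraic closure\<close>

lemma size_proots_alg_closed:
  fixes p :: "'a::alg_closed_field poly"
  shows "size (proots p) = Polynomial.degree p"
proof (cases "p = 0")
  case False
  then show ?thesis
  proof (induction "Polynomial.degree p" arbitrary: p)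
    case (Suc n)
    obtain x where "poly p x = 0" using alg_closed_imp_poly_has_root[of p] Suc by auto
    then obtain r where p: "p = [:- x, 1:] * r" by (auto simp: poly_eq_0_iff_dvd elim: dvdE)
    with Suc.prems have r: "r \<noteq> 0" by auto
    then have "Polynomial.degree p = Suc (Polynomial.degree r)" unfolding p by (subst degree_mult_eq) auto
    then have "size (proots r) = Polynomial.degree r" using Suc r by auto
    moreover have "proots p = proots [:- x, 1:] + proots r" unfolding p by (rule proots_mult) (use r in auto)
    ultimately show ?case using \<open>Polynomial.degree p = Suc (Polynomial.degree r)\<close> by simp
  qed (metis degree_0_id proots_const size_empty degree_eq_zeroE degree_pCons_0 zero_multiset_def)
qed auto

text \<open>The roots of \<open>X^(q^m) - X\<close>; for \<open>m > 0\<close> they form the field of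
  order \<open>q^m\<close>.\<close>

definition subfield_ac :: "nat \<Rightarrow> 'a::{field,finite} alg_closure set" where
  "subfield_ac m = {x. x ^ (card (UNIV :: 'a set) ^ m) = x}"

text \<open>The derivative of \<open>X^(q^m) - X\<close> is -1, so all its \<open>q^m\<close> roots
  are simple.\<close>

lemma card_subfield_ac:
  assumes "m > 0"
  shows "card (subfield_ac m :: 'a::{field,finite} alg_closure set) = card (UNIV :: 'a set) ^ m"
proof -
  define q where "q = card (UNIV :: 'a set)"
  define n where "n = q ^ m"
  have "card {0, 1 :: 'a} \<le> q" unfolding q_def by (rule card_mono) auto
  then have q: "q > 1" by simp
  have n: "n > 1" unfolding n_def by (rule one_less_power[OF q assms])
  have "CHAR('a) dvd n" unfolding n_def q_def using CHAR_dvd_CARD[where ?'a = 'a] assms by (meson dvd_power dvd_trans)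
  then have n0: "of_nat n = (0 :: 'a alg_closure)" by (simp add: of_nat_eq_0_iff_char_dvd)
  define p :: "'a alg_closure poly" where "p = Polynomial.monom 1 n - Polynomial.monom 1 1"
  have "Polynomial.coeff p n = 1" using n unfolding p_def by simp
  then have "Polynomial.degree p \<ge> n" by (simp add: le_degree)
  moreover have "Polynomial.degree p \<le> n" unfolding p_def
    by (intro degree_diff_le) (use n in \<open>auto simp: degree_monom_eq\<close>)
  ultimately have deg: "Polynomial.degree p = n" by simp
  have p0: "p \<noteq> 0" using deg n by auto
  have "poly (pderiv p) x = -1" for x
    unfolding p_def by (simp add: pderiv_diff pderiv_monom n0 poly_monom)
  then have ord: "Polynomial.order x p \<le> 1" for x
  proof (rule_tac ccontr)
    assume *: "\<And>x. poly (pderiv p) x = - 1" and "\<not> Polynomial.order x p \<le> 1"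
    then have "[:- x, 1:] ^ 2 dvd p" using order_1[of x p] power_le_dvd[of "[:- x, 1:]" "Polynomial.order x p" p 2] by simp
    then obtain r where "p = [:- x, 1:] ^ 2 * r" by (rule dvdE)
    moreover have "poly (pderiv (l ^ 2 * r)) x = 0" if "poly l x = 0" for l
      using that by (simp add: pderiv_mult power2_eq_square)
    from this[of "[:- x, 1:]"] calculation have "poly (pderiv p) x = 0" by simp
    with * show False by simp
  qed
  have "proots p = mset_set (set_mset (proots p))"
  proof (rule multiset_eqI)
    fix x show "count (proots p) x = count (mset_set (set_mset (proots p))) x"
      using ord[of x] p0 order_root[of p x] poly_roots_finite[OF p0] by (cases "poly p x = 0") (auto simp: le_Suc_eq)
  qed
  then have "card (set_mset (proots p)) = n"
    using size_proots_alg_closed[of p] deg by (metis finite_set_mset size_mset_set)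
  moreover have "set_mset (proots p) = subfield_ac m"
    using p0 unfolding p_def subfield_ac_def n_def q_def by (auto simp: poly_monom)
  ultimately show ?thesis unfolding n_def q_def by simp
qed

lemma subfield_ac_closed:
  fixes x y :: "'a::{field,finite} alg_closure" and a :: 'a
  shows "x \<in> subfield_ac m \<Longrightarrow> y \<in> subfield_ac m \<Longrightarrow> x + y \<in> subfield_ac m"
    and "x \<in> subfield_ac m \<Longrightarrow> - x \<in> subfield_ac m"
    and "x \<in> subfield_ac m \<Longrightarrow> y \<in> subfield_ac m \<Longrightarrow> x - y \<in> subfield_ac m"
    and "x \<in> subfield_ac m \<Longrightarrow> y \<in> subfield_ac m \<Longrightarrow> x * y \<in> subfield_ac m"
    and "x \<in> subfield_ac m \<Longrightarrow> y \<in> subfield_ac m \<Longrightarrow> x / y \<in> subfield_ac m"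
    and "to_ac a \<in> subfield_ac m"
proof -
  have *: "to_ac a \<in> subfield_ac m" for a :: 'a
  proof -
    have "a ^ (card (UNIV :: 'a set) ^ m) = a"
      by (induction m) (simp_all add: power_mult power_card_field)
    then show ?thesis unfolding subfield_ac_def by (simp flip: to_ac_power)
  qed
  have mult: "x \<in> subfield_ac m \<Longrightarrow> y \<in> subfield_ac m \<Longrightarrow> x * y \<in> subfield_ac m" for x y :: "'a alg_closure"
    unfolding subfield_ac_def by (simp add: power_mult_distrib)
  show "to_ac a \<in> subfield_ac m" by (rule *)
  show "x \<in> subfield_ac m \<Longrightarrow> y \<in> subfield_ac m \<Longrightarrow> x * y \<in> subfield_ac m" by (rule mult)
  show "x \<in> subfield_ac m \<Longrightarrow> y \<in> subfield_ac m \<Longrightarrow> x / y \<in> subfield_ac m"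
    unfolding subfield_ac_def by (simp add: power_divide)
  have add: "x \<in> subfield_ac m \<Longrightarrow> y \<in> subfield_ac m \<Longrightarrow> x + y \<in> subfield_ac m" for x y :: "'a alg_closure"
    unfolding subfield_ac_def by (simp add: frobenius_add)
  have minus: "x \<in> subfield_ac m \<Longrightarrow> - x \<in> subfield_ac m" for x :: "'a alg_closure"
    using mult[OF *[of "- 1"], of x] by simp
  show "x \<in> subfield_ac m \<Longrightarrow> y \<in> subfield_ac m \<Longrightarrow> x + y \<in> subfield_ac m" by (rule add)
  show "x \<in> subfield_ac m \<Longrightarrow> - x \<in> subfield_ac m" by (rule minus)
  show "x \<in> subfield_ac m \<Longrightarrow> y \<in> subfield_ac m \<Longrightarrow> x - y \<in> subfield_ac m"
    using add[OF _ minus, of x y] by simp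
qed

lemma subfield_ac_sum:
  assumes "\<And>j. j \<in> J \<Longrightarrow> g j \<in> subfield_ac m"
  shows "(\<Sum>j\<in>J. g j) \<in> (subfield_ac m :: 'a::{field,finite} alg_closure set)"
  using assms
  by (induction J rule: infinite_finite_induct)
    (use subfield_ac_closed(6)[of "0 :: 'a" m] in \<open>auto intro: subfield_ac_closed(1)\<close>)

text \<open>\<open>\<phi> x i\<close> is a coordinate of \<open>x\<close> in a basis over the base
  field. The basis has \<open>m\<close> elements because the \<open>q^m\<close> field elements
  correspond to the families of coefficients.\<close>

lemma subfield_ac_coordinates:
  assumes m: "m > 0"
  obtains \<phi> :: "'a::{field,finite} alg_closure \<Rightarrow> nat \<Rightarrow> 'a"
  where "\<And>x y i. x \<in> subfield_ac m \<Longrightarrow> y \<in> subfield_ac m \<Longrightarrow> \<phi> (x + y) i = \<phi> x i + \<phi> y i"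
    and "\<And>a x i. x \<in> subfield_ac m \<Longrightarrow> \<phi> (to_ac a * x) i = a * \<phi> x i"
    and "\<And>g. \<exists>x \<in> subfield_ac m. \<forall>i<m. \<phi> x i = g i"
proof -
  define q where "q = card (UNIV :: 'a set)"
  define K :: "'a alg_closure set" where "K = subfield_ac m"
  interpret vector_space "\<lambda>a x. to_ac (a :: 'a) * x" by unfold_locales (simp_all add: algebra_simps)
  have sub: "subspace K" unfolding K_def subspace_def
    using subfield_ac_closed(1,4,6)[where ?'a = 'a and m = m] subfield_ac_closed(6)[of "0 :: 'a" m] by simp
  have "card {0, 1 :: 'a} \<le> q" unfolding q_def by (rule card_mono) auto
  then have q: "q > 1" by simp
  have cK: "card K = q ^ m" unfolding K_def q_def using card_subfield_ac[OF m] .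
  have fK: "finite K" using cK q by (intro card_ge_0_finite) simp
  obtain B where B: "B \<subseteq> K" "independent B" "K \<subseteq> span B" by (rule basis_exists)
  have fB: "finite B" using B fK finite_subset by blast
  have KB: "K = span B" using span_minimal[OF B(1) sub] B(3) by blast
  have "bij_betw (\<lambda>c. \<Sum>b\<in>B. to_ac (c b) * b) (B \<rightarrow>\<^sub>E UNIV) K"
    unfolding bij_betw_def
  proof
    show "inj_on (\<lambda>c. \<Sum>b\<in>B. to_ac (c b :: 'a) * b) (B \<rightarrow>\<^sub>E UNIV)"
    proof (rule inj_onI)
      fix c d assume c: "c \<in> B \<rightarrow>\<^sub>E UNIV" "d \<in> B \<rightarrow>\<^sub>E UNIV" and "(\<Sum>b\<in>B. to_ac (c b :: 'a) * b) = (\<Sum>b\<in>B. to_ac (d b) * b)"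
      then have "(\<Sum>b\<in>B. to_ac (c b - d b) * b) = 0" by (simp add: algebra_simps sum_subtractf)
      then have "c b - d b = 0" if "b \<in> B" for b
        by (rule independentD[OF B(2) fB subset_refl _ that])
      then show "c = d" using c by (intro PiE_ext[OF c]) simp
    qed
    show "(\<lambda>c. \<Sum>b\<in>B. to_ac (c b :: 'a) * b) ` (B \<rightarrow>\<^sub>E UNIV) = K"
    proof
      show "(\<lambda>c. \<Sum>b\<in>B. to_ac (c b :: 'a) * b) ` (B \<rightarrow>\<^sub>E UNIV) \<subseteq> K"
        unfolding KB by (intro image_subsetI span_sum span_scale span_base)
      show "K \<subseteq> (\<lambda>c. \<Sum>b\<in>B. to_ac (c b :: 'a) * b) ` (B \<rightarrow>\<^sub>E UNIV)"
      proof
        fix x assume "x \<in> K"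
        then obtain u where "x = (\<Sum>b\<in>B. to_ac (u b) * b)" unfolding KB span_finite[OF fB] by auto
        then show "x \<in> (\<lambda>c. \<Sum>b\<in>B. to_ac (c b :: 'a) * b) ` (B \<rightarrow>\<^sub>E UNIV)"
          by (intro image_eqI[of _ _ "restrict u B"]) auto
      qed
    qed
  qed
  then have "q ^ card B = q ^ m" 
    using bij_betw_same_card[of _ "B \<rightarrow>\<^sub>E (UNIV :: 'a set)" K] fB unfolding cK[symmetric] by (simp add: card_PiE q_def)
  then have "card B = m" using q by simp
  then obtain b where b: "bij_betw b {..<m} B" using ex_bij_betw_nat_finite[OF fB] by (auto simp: atLeast0LessThan)
  define \<phi> where "\<phi> = (\<lambda>x i. representation B x (b i))"
  show thesis
  proof (rule that[of \<phi>])
    show "\<phi> (x + y) i = \<phi> x i + \<phi> y i" if "x \<in> subfield_ac m" "y \<in> subfield_ac m" for x y i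
      using that representation_add[OF B(2), of y x] KB unfolding \<phi>_def K_def by auto
    show "\<phi> (to_ac a * x) i = a * \<phi> x i" if "x \<in> subfield_ac m" for a x i
      using that representation_scale[OF B(2), of x a] KB unfolding \<phi>_def K_def by auto
    show "\<exists>x \<in> subfield_ac m. \<forall>i<m. \<phi> x i = g i" for g
    proof
      define x where "x = (\<Sum>j<m. to_ac (g j) * b j)"
      have bB: "b j \<in> B" if "j < m" for j using that b bij_betwE by blast
      have sp: "to_ac (g j) * b j \<in> span B" if "j < m" for j using bB[OF that] by (intro span_scale span_base)
      have "x \<in> span B" unfolding x_def by (rule span_sum) (use sp in simp)
      then show "x \<in> subfield_ac m" using KB unfolding K_def by simp
      show "\<forall>i<m. \<phi> x i = g i"
      proof (intro allI impI)
        fix i assume i: "i < m"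
        have "\<phi> x i = (\<Sum>j<m. representation B (to_ac (g j) * b j) (b i))"
          unfolding \<phi>_def x_def using sp by (subst representation_sum[OF B(2)]) auto
        also have "\<dots> = (\<Sum>j<m. if j = i then g i else 0)"
        proof (rule sum.cong)
          fix j assume "j \<in> {..<m}"
          then have "representation B (to_ac (g j) * b j) (b i) = g j * (if b i = b j then 1 else 0)"
            using bB[of j] by (simp add: representation_scale[OF B(2)] span_base representation_basis[OF B(2)])
          then show "representation B (to_ac (g j) * b j) (b i) = (if j = i then g i else 0)"
            using b i \<open>j \<in> {..<m}\<close> by (auto simp: bij_betw_def inj_on_eq_iff)
        qed simp
        also have "\<dots> = g i" using i by simp
        finally show "\<phi> x i = g i" .
      qed
    qed
  qed
qed

text \<open>Subtracting \<open>B k\<close> times each equation from the next one eliminates the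
  unknown at \<open>k\<close> and leaves a Vandermonde system for \<open>J\<close> in the unknowns
  \<open>\<theta> j * (B j - B k)\<close>. The equation for \<open>l = 0\<close> then gives the
  unknown at \<open>k\<close>.\<close>

lemma vandermonde_solution:
  fixes B :: "'b \<Rightarrow> 'a::{field,finite} alg_closure"
  assumes "finite J" "inj_on B J" "B ` J \<subseteq> subfield_ac m" "\<And>l. s l \<in> subfield_ac m"
  shows "\<exists>\<eta>. (\<forall>j\<in>J. \<eta> j \<in> subfield_ac m) \<and> (\<forall>l<card J. (\<Sum>j\<in>J. \<eta> j * B j ^ l) = s l)"
  using assms
proof (induction J arbitrary: s rule: finite_induct)
  case empty
  then show ?case by simp
next
  case (insert k J)
  note cl = subfield_ac_closed[of _ m]
  have B: "B j \<in> subfield_ac m" if "j \<in> insert k J" for j using insert.prems that by blast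
  define s' where "s' l = s (Suc l) - B k * s l" for l
  have "s' l \<in> subfield_ac m" for l unfolding s'_def using insert.prems(3) B by (intro cl) auto
  then have "\<exists>\<eta>. (\<forall>j\<in>J. \<eta> j \<in> subfield_ac m) \<and> (\<forall>l<card J. (\<Sum>j\<in>J. \<eta> j * B j ^ l) = s' l)"
    using insert.prems by (intro insert.IH) auto
  then obtain \<eta> where \<eta>: "\<And>j. j \<in> J \<Longrightarrow> \<eta> j \<in> subfield_ac m" "\<And>l. l < card J \<Longrightarrow> (\<Sum>j\<in>J. \<eta> j * B j ^ l) = s' l"
    by blast
  have nz: "B j - B k \<noteq> 0" if "j \<in> J" for j using insert.prems(1) insert.hyps that by (auto simp: inj_on_def)
  define \<theta> where "\<theta> j = (if j = k then s 0 - (\<Sum>j\<in>J. \<eta> j / (B j - B k)) else \<eta> j / (B j - B k))" for j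
  have \<theta>J: "\<theta> j * (B j - B k) = \<eta> j" "\<theta> j = \<eta> j / (B j - B k)" if "j \<in> J" for j
    using nz[OF that] that insert.hyps unfolding \<theta>_def by auto
  have quot: "\<eta> j / (B j - B k) \<in> subfield_ac m" if "j \<in> J" for j using that \<eta> B by (intro cl) auto
  have "(\<Sum>j\<in>J. \<eta> j / (B j - B k)) \<in> subfield_ac m" using quot by (rule subfield_ac_sum)
  then have 1: "\<theta> j \<in> subfield_ac m" if "j \<in> insert k J" for j
    using that insert.prems(3) quot unfolding \<theta>_def by (auto intro: cl)
  have 2: "(\<Sum>j\<in>insert k J. \<theta> j * B j ^ l) = s l" if "l < Suc (card J)" for l
    using that
  proof (induction l)
    case 0
    have "(\<Sum>j\<in>J. \<theta> j) = (\<Sum>j\<in>J. \<eta> j / (B j - B k))" using \<theta>J(2) by (intro sum.cong) auto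
    then show ?case using insert.hyps by (simp add: \<theta>_def[of k])
  next
    case (Suc l)
    have "(\<Sum>j\<in>insert k J. \<theta> j * B j ^ Suc l) = B k * (\<Sum>j\<in>insert k J. \<theta> j * B j ^ l)
       + (\<Sum>j\<in>insert k J. \<theta> j * (B j - B k) * B j ^ l)"
      by (simp add: sum_distrib_left sum.distrib[symmetric] algebra_simps del: sum.insert)
    also have "(\<Sum>j\<in>insert k J. \<theta> j * (B j - B k) * B j ^ l) = s' l"
      using insert.hyps \<theta>J \<eta>(2)[of l] Suc by simp
    finally show ?case using Suc unfolding s'_def by simp
  qed
  show ?case using 1 2 insert.hyps by (intro exI[of _ \<theta>]) auto
qed

section \<open>Codes and saturating sets\<close>

lemma card_carrier_vec:
  "finite (carrier_vec n :: 'a::finite vec set)"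
  "card (carrier_vec n :: 'a::finite vec set) = card (UNIV :: 'a set) ^ n"
proof -
  let ?F = "{..<n} \<rightarrow>\<^sub>E (UNIV :: 'a set)"
  have inj: "inj_on (vec n) ?F"
  proof (rule inj_onI)
    fix g h :: "nat \<Rightarrow> 'a" assume g: "g \<in> ?F" and h: "h \<in> ?F" and eq: "vec n g = vec n h"
    show "g = h"
    proof (rule PiE_ext[OF g h])
      fix i assume "i \<in> {..<n}"
      then show "g i = h i" using arg_cong[OF eq, of "\<lambda>v. v $ i"] by simp
    qed
  qed
  have image: "vec n ` ?F = carrier_vec n"
  proof
    show "carrier_vec n \<subseteq> vec n ` ?F"
    proof
      fix v :: "'a vec" assume "v \<in> carrier_vec n"
      then have "v = vec n (restrict (\<lambda>i. v $ i) {..<n})" by (intro eq_vecI) (simp_all add: carrier_vecD)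
      moreover have "restrict (\<lambda>i. v $ i) {..<n} \<in> ?F" by simp
      ultimately show "v \<in> vec n ` ?F" by (rule image_eqI)
    qed
  qed (rule image_subsetI, rule vec_carrier)
  have fin: "finite ?F" by (intro finite_PiE) simp_all
  show "finite (carrier_vec n :: 'a vec set)"
    using finite_imageI[OF fin, of "vec n"] unfolding image .
  show "card (carrier_vec n :: 'a vec set) = card (UNIV :: 'a set) ^ n"
    using card_image[OF inj] unfolding image by (simp add: card_PiE)
qed

section \<open>Spans and coverings\<close>

lemma vspan_iff:
  assumes "finite B" "B \<subseteq> carrier_vec r"
  shows "v \<in> vspan r B \<longleftrightarrow> v \<in> carrier_vec r \<and> (\<exists>c. \<forall>i<r. v $ i = (\<Sum>b\<in>B. c b * b $ i))"
proof -
  interpret vec_space "TYPE('a)" r .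
  have span: "span B = {lincomb c B |c. True}" using finite_span[of B] assms by simp
  have index: "lincomb c B $ i = (\<Sum>b\<in>B. c b * b $ i)" if "i < r" for c i
    using lincomb_index[OF that assms(2)] .
  have dim: "lincomb c B \<in> carrier_vec r" for c using lincomb_closed[of B c] assms by simp
  show ?thesis
  proof
    assume "v \<in> span B"
    then show "v \<in> carrier_vec r \<and> (\<exists>c. \<forall>i<r. v $ i = (\<Sum>b\<in>B. c b * b $ i))"
      unfolding span using index dim by blast
  next
    assume "v \<in> carrier_vec r \<and> (\<exists>c. \<forall>i<r. v $ i = (\<Sum>b\<in>B. c b * b $ i))"
    then obtain c where v: "v \<in> carrier_vec r" "\<And>i. i < r \<Longrightarrow> v $ i = (\<Sum>b\<in>B. c b * b $ i)" by blast
    have "v = lincomb c B" by (rule eq_vecI) (use v index dim[of c] in auto)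
    then show "v \<in> span B" unfolding span by blast
  qed
qed

lemma vspan_carrier: "B \<subseteq> carrier_vec r \<Longrightarrow> vspan r B \<subseteq> carrier_vec r"
proof -
  interpret vec_space "TYPE('a)" r .
  show "B \<subseteq> carrier_vec r \<Longrightarrow> span B \<subseteq> carrier_vec r" using span_is_subset2[of B] by simp
qed

lemma vspan_mono: "A \<subseteq> B \<Longrightarrow> vspan r A \<subseteq> vspan r B"
proof -
  interpret vec_space "TYPE('a)" r .
  show "A \<subseteq> B \<Longrightarrow> span A \<subseteq> span B" by (rule span_is_monotone)
qed

lemma vspan_minimal: "B \<subseteq> carrier_vec r \<Longrightarrow> A \<subseteq> vspan r B \<Longrightarrow> vspan r A \<subseteq> vspan r B"
proof -
  interpret vec_space "TYPE('a)" r .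
  show "B \<subseteq> carrier_vec r \<Longrightarrow> A \<subseteq> span B \<Longrightarrow> span A \<subseteq> span B" by (rule span_subsetI)
qed

lemma vspan_base: "B \<subseteq> carrier_vec r \<Longrightarrow> B \<subseteq> vspan r B"
proof -
  interpret vec_space "TYPE('a)" r .
  show "B \<subseteq> carrier_vec r \<Longrightarrow> B \<subseteq> span B" using in_own_span[of B] by simp
qed

lemma vspan_smult: "B \<subseteq> carrier_vec r \<Longrightarrow> x \<in> vspan r B \<Longrightarrow> c \<cdot>\<^sub>v x \<in> vspan r B"
proof -
  interpret vec_space "TYPE('a)" r .
  show "B \<subseteq> carrier_vec r \<Longrightarrow> x \<in> span B \<Longrightarrow> c \<cdot>\<^sub>v x \<in> span B" by (rule smult_in_span)
qed

lemma vspan_add: "B \<subseteq> carrier_vec r \<Longrightarrow> x \<in> vspan r B \<Longrightarrow> y \<in> vspan r B \<Longrightarrow> x + y \<in> vspan r B"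
proof -
  interpret vec_space "TYPE('a)" r .
  show "B \<subseteq> carrier_vec r \<Longrightarrow> x \<in> span B \<Longrightarrow> y \<in> span B \<Longrightarrow> x + y \<in> span B" using span_add1[of B x y] by simp
qed

text \<open>The condition behind both \<open>covering_radius\<close> and
  \<open>combinations_cover\<close>, for a set of vectors; codes and saturating sets are compared
  through it.\<close>

definition covers :: "nat \<Rightarrow> nat \<Rightarrow> 'a::field vec set \<Rightarrow> bool" where
  "covers r k X \<longleftrightarrow> (\<forall>v\<in>carrier_vec r. \<exists>B\<subseteq>X. card B \<le> k \<and> v \<in> vspan r B)"

lemma coversE:
  assumes "covers r k X" "v \<in> carrier_vec r"
  obtains B where "B \<subseteq> X" "card B \<le> k" "v \<in> vspan r B"
  using assms unfolding covers_def by blast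

lemma covers_mono:
  assumes "covers r k X" "k \<le> l"
  shows "covers r l X"
  unfolding covers_def
proof
  fix v :: "'a vec" assume "v \<in> carrier_vec r"
  with assms(1) obtain B where "B \<subseteq> X" "card B \<le> k" "v \<in> vspan r B" by (rule coversE)
  then show "\<exists>B\<subseteq>X. card B \<le> l \<and> v \<in> vspan r B" using assms(2) by (intro exI[of _ B]) simp
qed

lemma covers_subset:
  assumes "covers r k X" "X \<subseteq> Y"
  shows "covers r k Y"
  unfolding covers_def
proof
  fix v :: "'a vec" assume "v \<in> carrier_vec r"
  with assms(1) obtain B where "B \<subseteq> X" "card B \<le> k" "v \<in> vspan r B" by (rule coversE)
  then show "\<exists>B\<subseteq>Y. card B \<le> k \<and> v \<in> vspan r B" using assms(2) by (intro exI[of _ B]) simp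
qed

lemma covers_imp_vspan:
  assumes "covers r k X" "X \<subseteq> carrier_vec r"
  shows "vspan r X = carrier_vec r"
proof (rule antisym[OF vspan_carrier[OF assms(2)]], rule subsetI)
  fix v :: "'a vec" assume "v \<in> carrier_vec r"
  then obtain B where "B \<subseteq> X" "v \<in> vspan r B" using assms(1) unfolding covers_def by blast
  then show "v \<in> vspan r X" using vspan_mono[of B X r] by (rule_tac subsetD)
qed

lemma vspan_imp_covers: "vspan r X = carrier_vec r \<Longrightarrow> covers r (card X) X"
  unfolding covers_def by auto

text \<open>By monotonicity, \<open>R\<close> is the least number that covers. The truncated
  \<open>R - 1\<close> gives it this meaning only for \<open>R > 0\<close>.\<close>

definition exact_cover :: "nat \<Rightarrow> nat \<Rightarrow> 'a::field vec set \<Rightarrow> bool" where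
  "exact_cover r R X \<longleftrightarrow> covers r R X \<and> \<not> covers r (R - 1) X"

lemma Least_covers:
  assumes "covers r k X" "R > 0"
  shows "(LEAST R. covers r R X) = R \<longleftrightarrow> exact_cover r R X"
proof
  assume *: "(LEAST R. covers r R X) = R"
  then show "exact_cover r R X" unfolding exact_cover_def
    using LeastI[of "\<lambda>R. covers r R X", OF assms(1)] not_less_Least[of "R - 1" "\<lambda>R. covers r R X"] assms(2) by auto
next
  assume *: "exact_cover r R X"
  show "(LEAST R. covers r R X) = R"
  proof (rule Least_equality)
    show "R \<le> k" if "covers r k X" for k
      using * covers_mono[OF that, of "R - 1"] unfolding exact_cover_def by (cases "k \<le> R - 1") auto
  qed (use * in \<open>auto simp: exact_cover_def\<close>)
qed

section \<open>Projective points and their coordinate vectors\<close>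

lemma proj_point_self: "v \<in> proj_point v"
proof -
  have "v = 1 \<cdot>\<^sub>v v" by simp
  then show ?thesis unfolding proj_point_def using one_neq_zero by blast
qed

lemma proj_point_subset_vspan:
  assumes "B \<subseteq> carrier_vec r"
  shows "proj_point v \<subseteq> vspan r B \<longleftrightarrow> v \<in> vspan r B"
proof
  assume "proj_point v \<subseteq> vspan r B"
  then show "v \<in> vspan r B" using proj_point_self by (rule subsetD)
next
  assume v: "v \<in> vspan r B"
  show "proj_point v \<subseteq> vspan r B"
  proof
    fix x assume "x \<in> proj_point v"
    then obtain c where "x = c \<cdot>\<^sub>v v" unfolding proj_point_def by blast
    then show "x \<in> vspan r B" using vspan_smult[OF assms v] by simp
  qed
qed

lemma vspan_proj_points:
  assumes "B \<subseteq> carrier_vec r"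
  shows "vspan r (\<Union> (proj_point ` B)) = vspan r B"
proof (rule antisym)
  have "proj_point b \<subseteq> vspan r B" if "b \<in> B" for b
    unfolding proj_point_subset_vspan[OF assms] using vspan_base[OF assms] that by (rule subsetD)
  then show "vspan r (\<Union> (proj_point ` B)) \<subseteq> vspan r B"
    by (intro vspan_minimal assms UN_least)
  show "vspan r B \<subseteq> vspan r (\<Union> (proj_point ` B))"
  proof (intro vspan_mono subsetI)
    fix b assume "b \<in> B"
    then show "b \<in> \<Union> (proj_point ` B)" using proj_point_self by (rule UN_I)
  qed
qed

lemma combinations_cover_iff:
  fixes X :: "'a::{field,finite} vec set"
  assumes r: "r > 0" and X: "X \<subseteq> carrier_vec r"
  shows "combinations_cover (r - 1) k (proj_point ` X) \<longleftrightarrow> covers r k X"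
proof -
  have finX: "finite X" using X card_carrier_vec(1) finite_subset by blast
  have r': "r - 1 + 1 = r" using r by simp
  show ?thesis
  proof
    assume L: "combinations_cover (r - 1) k (proj_point ` X)"
    show "covers r k X" unfolding covers_def
    proof
      fix v :: "'a vec" assume v: "v \<in> carrier_vec r"
      show "\<exists>B\<subseteq>X. card B \<le> k \<and> v \<in> vspan r B"
      proof (cases "v = 0\<^sub>v r")
        case True
        \<comment> \<open>The zero vector is not a projective point; the empty combination covers
          it.\<close>
        then have "v \<in> vspan r {}" by (subst vspan_iff) auto
        then show ?thesis by (intro exI[of _ "{}"]) auto
      next
        case False
        with L v obtain T where T: "T \<subseteq> proj_point ` X" "card T \<le> k" "proj_point v \<subseteq> vspan r (\<Union> T)"
          unfolding combinations_cover_def proj_space_def r' by blast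
        \<comment> \<open>One coordinate vector is chosen for each point of \<open>T\<close>, so the
          count does not grow.\<close>
        obtain B where B: "B \<subseteq> X" "inj_on proj_point B" "T = proj_point ` B"
          using T(1) unfolding subset_image_inj by blast
        have BC: "B \<subseteq> carrier_vec r" using B(1) X by blast
        have "v \<in> vspan r B" using T(3) proj_point_subset_vspan[OF BC] unfolding B(3) vspan_proj_points[OF BC] by blast
        then show ?thesis using B T(2) card_image[OF B(2)] by auto
      qed
    qed
  next
    assume R: "covers r k X"
    show "combinations_cover (r - 1) k (proj_point ` X)" unfolding combinations_cover_def r'
    proof
      fix P assume "P \<in> (proj_space (r - 1) :: 'a vec set set)"
      then obtain v where v: "P = proj_point v" "v \<in> carrier_vec r" unfolding proj_space_def r' by blast
      then obtain B where B: "B \<subseteq> X" "card B \<le> k" "v \<in> vspan r B" using R unfolding covers_def by blast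
      have BC: "B \<subseteq> carrier_vec r" using B(1) X by blast
      have "P \<subseteq> vspan r (\<Union> (proj_point ` B))"
        unfolding v vspan_proj_points[OF BC] using proj_point_subset_vspan[OF BC] B(3) by blast
      moreover have "card (proj_point ` B) \<le> k" 
        using card_image_le[OF finite_subset[OF B(1) finX], of proj_point] B(2) by simp
      ultimately show "\<exists>T\<subseteq>proj_point ` X. card T \<le> k \<and> P \<subseteq> vspan r (\<Union> T)"
        using image_mono[OF B(1), of proj_point] by (intro exI[of _ "proj_point ` B"]) simp
    qed
  qed
qed

lemma saturating_iff:
  fixes X :: "'a::{field,finite} vec set"
  assumes r: "r > 0" and X: "X \<subseteq> carrier_vec r - {0\<^sub>v r}" and R: "R \<ge> 2"
  shows "saturating (r - 1) (R - 1) (proj_point ` X) \<longleftrightarrow> exact_cover r R X"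
proof -
  have X': "X \<subseteq> carrier_vec r" using X by blast
  have "proj_point ` X \<subseteq> proj_space (r - 1)"
  proof (rule image_subsetI)
    fix x assume "x \<in> X"
    then have "x \<in> carrier_vec (r - 1 + 1)" "x \<noteq> 0\<^sub>v (r - 1 + 1)" using X r by auto
    then show "proj_point x \<in> proj_space (r - 1)" unfolding proj_space_def by blast
  qed
  moreover have "(\<forall>\<rho>'<R - 1. \<not> covers r (\<rho>' + 1) X) \<longleftrightarrow> \<not> covers r (R - 1) X"
  proof
    assume *: "\<forall>\<rho>'<R - 1. \<not> covers r (\<rho>' + 1) X"
    \<comment> \<open>The largest smaller parameter is \<open>\<rho>' = R - 2\<close>, which exists
      by \<open>R \<ge> 2\<close> and stands for \<open>R - 1\<close> vectors.\<close>
    have "R - 2 < R - 1" "R - 2 + 1 = R - 1" using R by auto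
    then show "\<not> covers r (R - 1) X" using * by metis
  next
    assume *: "\<not> covers r (R - 1) X"
    show "\<forall>\<rho>'<R - 1. \<not> covers r (\<rho>' + 1) X"
      using * covers_mono[of r _ X "R - 1"] by (metis Suc_eq_plus1 Suc_leI)
  qed
  ultimately show ?thesis unfolding saturating_def combinations_cover_iff[OF r X'] exact_cover_def using R by auto
qed

section \<open>Kernels and column spaces by counting\<close>

lemma ex1_implies_unique: "\<exists>!x. P x \<Longrightarrow> P a \<Longrightarrow> P b \<Longrightarrow> a = b"
  by blast

lemma card_vectorspace:
  assumes "vectorspace K V" "finite A" "vectorspace.basis K V A"
  shows "card (carrier V) = card (carrier K) ^ card A"
proof -
  interpret vectorspace K V by fact
  have A: "A \<subseteq> carrier V" using assms(3) unfolding basis_def by blast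
  have ex1: "\<exists>!a. a \<in> A \<rightarrow>\<^sub>E carrier K \<and> lincomb a A = v" if "v \<in> carrier V" for v
    using basis_criterion[OF assms(2) A] assms(3) that by blast
  have closed: "lincomb a A \<in> carrier V" if "a \<in> A \<rightarrow>\<^sub>E carrier K" for a
    using that A by (intro lincomb_closed) auto
  have "bij_betw (\<lambda>a. lincomb a A) (A \<rightarrow>\<^sub>E carrier K) (carrier V)"
    unfolding bij_betw_def
  proof
    show "inj_on (\<lambda>a. lincomb a A) (A \<rightarrow>\<^sub>E carrier K)"
    proof (rule inj_onI)
      fix a b assume ab: "a \<in> A \<rightarrow>\<^sub>E carrier K" "b \<in> A \<rightarrow>\<^sub>E carrier K" "lincomb a A = lincomb b A"
      show "a = b"
        by (rule ex1_implies_unique[OF ex1[OF closed[OF ab(1)]]]) (use ab in simp_all)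
    qed
    show "(\<lambda>a. lincomb a A) ` (A \<rightarrow>\<^sub>E carrier K) = carrier V"
    proof (rule antisym)
      show "carrier V \<subseteq> (\<lambda>a. lincomb a A) ` (A \<rightarrow>\<^sub>E carrier K)"
      proof
        fix v assume "v \<in> carrier V"
        from ex1_implies_ex[OF ex1[OF this]]
        obtain a where a: "a \<in> A \<rightarrow>\<^sub>E carrier K" "lincomb a A = v" by (elim exE conjE)
        show "v \<in> (\<lambda>a. lincomb a A) ` (A \<rightarrow>\<^sub>E carrier K)" unfolding a(2)[symmetric] using a(1) by (rule imageI)
      qed
    qed (rule image_subsetI, rule closed)
  qed
  then have "card (A \<rightarrow>\<^sub>E carrier K) = card (carrier V)" by (rule bij_betw_same_card)
  then show ?thesis using assms(2) by (simp add: card_PiE)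
qed

lemma card_mat_kernel:
  fixes H :: "'a::{field,finite} mat"
  assumes H: "H \<in> carrier_mat r n"
  shows "card (mat_kernel H) = card (UNIV :: 'a set) ^ kernel.dim n H"
proof -
  interpret kernel r n H by unfold_locales (rule H)
  obtain B where B: "finite B" "basis B" using kernel_basis_exists[OF H] by blast
  show ?thesis using card_vectorspace[OF Ker.vectorspace_axioms B] Ker.dim_basis[OF B] by (simp add: class_ring_simps)
qed

text \<open>Rank and nullity in counting form: each nonempty fibre is a translate of the
  kernel.\<close>

lemma card_image_kernel:
  fixes H :: "'a::{field,finite} mat"
  assumes H: "H \<in> carrier_mat r n"
  shows "card ((\<lambda>x. H *\<^sub>v x) ` carrier_vec n) * card (mat_kernel H) = card (UNIV :: 'a set) ^ n"
proof -
  let ?f = "\<lambda>x. H *\<^sub>v x"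
  have fib: "card {x \<in> carrier_vec n. ?f x = y} = card (mat_kernel H)" if y: "y \<in> ?f ` carrier_vec n" for y
  proof -
    from y obtain x0 where x0: "y = H *\<^sub>v x0" "x0 \<in> carrier_vec n" by (rule imageE)
    have "bij_betw (\<lambda>x. x - x0) {x \<in> carrier_vec n. ?f x = y} (mat_kernel H)"
    proof (rule bij_betwI[where g = "\<lambda>x. x + x0"])
      show "(\<lambda>x. x - x0) \<in> {x \<in> carrier_vec n. ?f x = y} \<rightarrow> mat_kernel H"
      proof
        fix x assume "x \<in> {x \<in> carrier_vec n. ?f x = y}"
        then have x: "x \<in> carrier_vec n" "H *\<^sub>v x = H *\<^sub>v x0" using x0(1) by simp_all
        then have "H *\<^sub>v (x - x0) = 0\<^sub>v r"
          using x0 H by (simp add: mult_minus_distrib_mat_vec[OF H])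
        with x x0 show "x - x0 \<in> mat_kernel H" by (intro mat_kernelI[OF H]) simp_all
      qed
      show "(\<lambda>x. x + x0) \<in> mat_kernel H \<rightarrow> {x \<in> carrier_vec n. ?f x = y}"
      proof
        fix x assume "x \<in> mat_kernel H"
        then have "x \<in> carrier_vec n" "H *\<^sub>v x = 0\<^sub>v r" using mat_kernelD[OF H] by simp_all
        then show "x + x0 \<in> {x \<in> carrier_vec n. ?f x = y}"
          using x0 H by (simp add: mult_add_distrib_mat_vec[OF H])
      qed
    next
      fix x assume "x \<in> {x \<in> carrier_vec n. ?f x = y}"
      then have "x \<in> carrier_vec n" by simp
      then show "x - x0 + x0 = x" using x0(2) by (intro eq_vecI) simp_all
    next
      fix x assume "x \<in> mat_kernel H"
      then have "x \<in> carrier_vec n" using mat_kernelD[OF H] by simp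
      then show "x + x0 - x0 = x" using x0(2) by (intro eq_vecI) simp_all
    qed
    then show ?thesis by (rule bij_betw_same_card)
  qed
  have "card (UNIV :: 'a set) ^ n = card (carrier_vec n :: 'a vec set)" by (simp add: card_carrier_vec)
  also have "\<dots> = (\<Sum>y \<in> ?f ` carrier_vec n. card {x \<in> carrier_vec n. ?f x = y})"
    using sum.image_gen[OF card_carrier_vec(1), where h = "\<lambda>_. 1 :: nat" and g = ?f] by simp
  also have "\<dots> = card (?f ` carrier_vec n) * card (mat_kernel H)" using fib by simp
  finally show ?thesis by simp
qed

lemma image_eq_vspan_cols:
  assumes H: "H \<in> carrier_mat r n"
  shows "(\<lambda>x. H *\<^sub>v x) ` carrier_vec n = vspan r (set (cols H))"
proof -
  interpret vec_space "TYPE('a)" r .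
  show ?thesis using col_space_eq[OF H] H unfolding col_space_def by auto
qed

lemma finite_card_field_ge_2: "card (UNIV :: 'a::{field,finite} set) \<ge> 2"
proof -
  have "card {0, 1 :: 'a} \<le> card (UNIV :: 'a set)" by (rule card_mono) auto
  then show ?thesis by simp
qed

text \<open>Counting image and kernel: the kernel has dimension \<open>n - r\<close> iff the columns
  span \<open>q^r\<close> vectors, that is, the whole space.\<close>

lemma kernel_dim_iff:
  fixes H :: "'a::{field,finite} mat"
  assumes H: "H \<in> carrier_mat r n"
  shows "r \<le> n \<and> kernel.dim n H = n - r \<longleftrightarrow> vspan r (set (cols H)) = carrier_vec r"
proof -
  define q where "q = card (UNIV :: 'a set)"
  have q: "q > 1" using finite_card_field_ge_2[where ?'a = 'a] unfolding q_def by simp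
  let ?S = "vspan r (set (cols H))"
  have S: "?S \<subseteq> carrier_vec r" using H cols_dim[of H] by (intro vspan_carrier) auto
  have prod: "card ?S * q ^ kernel.dim n H = q ^ n"
    using card_image_kernel[OF H] unfolding image_eq_vspan_cols[OF H] card_mat_kernel[OF H] q_def .
  have full: "?S = carrier_vec r \<longleftrightarrow> card ?S = q ^ r"
    using card_subset_eq[OF card_carrier_vec(1) S] card_carrier_vec(2)[of r, where ?'a = 'a] unfolding q_def by metis
  show ?thesis unfolding full
  proof
    assume *: "r \<le> n \<and> kernel.dim n H = n - r"
    then have "card ?S * q ^ (n - r) = q ^ r * q ^ (n - r)" using prod by (simp flip: power_add)
    then show "card ?S = q ^ r" using q by simp
  next
    assume "card ?S = q ^ r"
    then have "q ^ (r + kernel.dim n H) = q ^ n" using prod by (simp add: power_add)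
    then have "r + kernel.dim n H = n" using q by simp
    then show "r \<le> n \<and> kernel.dim n H = n - r" by simp
  qed
qed

lemma linear_code_kernel:
  fixes H :: "'a::{field,finite} mat"
  assumes H: "H \<in> carrier_mat r n"
  shows "linear_code n k (mat_kernel H) \<longleftrightarrow> kernel.dim n H = k"
proof -
  interpret kernel r n H by unfold_locales (rule H)
  have "VectorSpace.subspace class_ring (mat_kernel H) (module_vec TYPE('a) n)"
    unfolding VectorSpace.subspace_def submodule_def
    using NC.vectorspace_axioms Ker.module_axioms NC.module_axioms mat_kernel[OF H]
    by (auto simp: mult_add_distrib_mat_vec[OF H] mult_mat_vec[OF H])
  then show ?thesis unfolding linear_code_def by simp
qed

text \<open>The list stands for the columns of a parity check matrix, so it may contain repetitions and zero.\<close>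

lemma length_code_iff:
  assumes R: "R > 0"
  shows "(r \<le> n \<and> (\<exists>(C :: 'a::{field,finite} vec set) H. linear_code n (n - r) C \<and> parity_check_matrix r n H C \<and>
           covering_radius H = R)) \<longleftrightarrow>
    (\<exists>xs :: 'a vec list. length xs = n \<and> set xs \<subseteq> carrier_vec r \<and> exact_cover r R (set xs))"
proof -
  have cr: "covering_radius H = (LEAST R. covers r R (set (cols H)))" if "H \<in> carrier_mat r n" for H :: "'a mat"
    using that unfolding covering_radius_def covers_def by auto
  show ?thesis
  proof
    assume "r \<le> n \<and> (\<exists>(C :: 'a vec set) H. linear_code n (n - r) C \<and> parity_check_matrix r n H C \<and> covering_radius H = R)"
    then obtain H :: "'a mat" where H: "r \<le> n" "linear_code n (n - r) (mat_kernel H)" "H \<in> carrier_mat r n" "covering_radius H = R"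
      unfolding parity_check_matrix_def by blast
    then have "vspan r (set (cols H)) = carrier_vec r" using kernel_dim_iff linear_code_kernel by blast
    from Least_covers[OF vspan_imp_covers[OF this] R] have "exact_cover r R (set (cols H))"
      using H(4) unfolding cr[OF H(3)] by blast
    then show "\<exists>xs :: 'a vec list. length xs = n \<and> set xs \<subseteq> carrier_vec r \<and> exact_cover r R (set xs)"
      using H(3) cols_dim[of H] by (intro exI[of _ "cols H"]) auto
  next
    assume "\<exists>xs :: 'a vec list. length xs = n \<and> set xs \<subseteq> carrier_vec r \<and> exact_cover r R (set xs)"
    then obtain xs :: "'a vec list" where xs: "length xs = n" "set xs \<subseteq> carrier_vec r" "exact_cover r R (set xs)" by blast
    define H where "H = mat_of_cols r xs"
    have H: "H \<in> carrier_mat r n" "cols H = xs" unfolding H_def using xs by auto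
    have cov: "covers r R (set xs)" using xs(3) unfolding exact_cover_def by blast
    have "r \<le> n \<and> linear_code n (n - r) (mat_kernel H)"
      using kernel_dim_iff[OF H(1)] linear_code_kernel[OF H(1)] covers_imp_vspan[OF cov xs(2)] H(2) by simp
    moreover have "covering_radius H = R"
      unfolding cr[OF H(1)] H(2) using Least_covers[OF cov R] xs(3) by blast
    ultimately show "r \<le> n \<and> (\<exists>(C :: 'a vec set) H. linear_code n (n - r) C \<and> parity_check_matrix r n H C \<and> covering_radius H = R)"
      using H(1) unfolding parity_check_matrix_def by blast
  qed
qed

section \<open>The length function and saturating sets\<close>

lemma exact_cover_remove_zero:
  fixes X :: "'a::{field,finite} vec set"
  assumes "X \<subseteq> carrier_vec r"
  shows "exact_cover r R (X - {0\<^sub>v r}) \<longleftrightarrow> exact_cover r R X"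
proof -
  have "covers r k (X - {0\<^sub>v r}) \<longleftrightarrow> covers r k X" for k
  proof
    assume "covers r k (X - {0\<^sub>v r})"
    then show "covers r k X" by (rule covers_subset) (rule Diff_subset)
  next
    assume X: "covers r k X"
    show "covers r k (X - {0\<^sub>v r})" unfolding covers_def
    proof
      fix v :: "'a vec" assume "v \<in> carrier_vec r"
      then obtain B where B: "B \<subseteq> X" "card B \<le> k" "v \<in> vspan r B" using X unfolding covers_def by blast
      have BC: "B \<subseteq> carrier_vec r" using B(1) assms by (rule subset_trans)
      have fin: "finite B" using BC card_carrier_vec(1) by (rule finite_subset)
      have C0: "B - {0\<^sub>v r} \<subseteq> carrier_vec r" using Diff_subset BC by (rule subset_trans)
      have "vspan r B \<subseteq> vspan r (B - {0\<^sub>v r})"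
      proof (intro vspan_minimal C0 subsetI)
        fix b assume "b \<in> B"
        show "b \<in> vspan r (B - {0\<^sub>v r})"
        proof (cases "b = 0\<^sub>v r")
          case True
          then show ?thesis unfolding vspan_iff[OF finite_Diff[OF fin] C0]
            by (intro conjI exI[of _ "\<lambda>_. 0"]) simp_all
        next
          case False
          with \<open>b \<in> B\<close> have "b \<in> B - {0\<^sub>v r}" by simp
          then show ?thesis by (rule subsetD[OF vspan_base[OF C0]])
        qed
      qed
      moreover have "card (B - {0\<^sub>v r}) \<le> k" using B(2) card_mono[OF fin Diff_subset, of "{0\<^sub>v r}"] by simp
      moreover have "B - {0\<^sub>v r} \<subseteq> X - {0\<^sub>v r}" using B(1) by (rule Diff_mono) simp
      ultimately show "\<exists>B\<subseteq>X - {0\<^sub>v r}. card B \<le> k \<and> v \<in> vspan r B"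
        using subsetD[OF _ B(3)] by (intro exI[of _ "B - {0\<^sub>v r}"] conjI)
    qed
  qed
  then show ?thesis unfolding exact_cover_def by simp
qed

text \<open>A zero column never helps and is removed, and proportional columns give the same point.
  Hence the number of points may be smaller.\<close>

lemma exact_saturating:
  fixes X :: "'a::{field,finite} vec set"
  assumes "X \<subseteq> carrier_vec r" "exact_cover r R X" "R \<ge> 2" "r > 0"
  shows "\<exists>S :: 'a vec set set. saturating (r - 1) (R - 1) S \<and> card S \<le> card X"
proof (intro exI conjI)
  let ?Y = "X - {0\<^sub>v r}"
  show "saturating (r - 1) (R - 1) (proj_point ` ?Y)"
    using saturating_iff[OF assms(4) Diff_mono[OF assms(1) subset_refl] assms(3)]
      exact_cover_remove_zero[OF assms(1)] assms(2) by simp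
  have "finite X" using assms(1) card_carrier_vec(1) by (rule finite_subset)
  then show "card (proj_point ` ?Y) \<le> card X"
    using card_image_le[of ?Y proj_point] card_mono[of X ?Y] by simp
qed

lemma saturating_exact:
  fixes S :: "'a::{field,finite} vec set set"
  assumes S: "saturating (r - 1) (R - 1) S" and "R \<ge> 2" "r > 0"
  shows "\<exists>X \<subseteq> (carrier_vec r :: 'a vec set). exact_cover r R X \<and> card X = card S"
proof -
  have r: "r - 1 + 1 = r" using \<open>r > 0\<close> by simp
  have "S \<subseteq> proj_point ` (carrier_vec r - {0\<^sub>v r})"
  proof
    fix P assume "P \<in> S"
    then have "P \<in> proj_space (r - 1)" using S unfolding saturating_def by (elim conjE) (rule subsetD)
    then obtain v where "P = proj_point v" "v \<in> carrier_vec r" "v \<noteq> 0\<^sub>v r"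
      unfolding proj_space_def r by (elim CollectE exE conjE)
    then show "P \<in> proj_point ` (carrier_vec r - {0\<^sub>v r})" by (intro image_eqI[of _ _ v]) simp_all
  qed
  then obtain X where X: "X \<subseteq> carrier_vec r - {0\<^sub>v r}" "inj_on proj_point X" "S = proj_point ` X"
    unfolding subset_image_inj by (elim exE conjE)
  have 1: "exact_cover r R X" using S saturating_iff[OF assms(3) X(1) assms(2)] unfolding X(3) by simp
  have 2: "X \<subseteq> carrier_vec r" using X(1) Diff_subset by (rule subset_trans)
  have 3: "card X = card S" using card_image[OF X(2)] unfolding X(3) by simp
  show ?thesis by (rule exI[of _ X]) (simp only: 1 2 3 simp_thms)
qed

lemma Least_eq_if_interleaved:
  fixes P Q :: "nat \<Rightarrow> bool"
  assumes QP: "\<And>n. Q n \<Longrightarrow> P n" and PQ: "\<And>n. P n \<Longrightarrow> \<exists>m\<le>n. Q m"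
  shows "Least P = Least Q"
proof (cases "\<exists>n. P n")
  case True
  then have P: "P (Least P)" by (rule LeastI_ex)
  from PQ[OF P] obtain m where m: "m \<le> Least P" "Q m" by blast
  have "Least Q \<le> m" using m(2) by (rule Least_le)
  moreover have "Least P \<le> Least Q" using QP[OF LeastI[of Q, OF m(2)]] by (rule Least_le)
  ultimately show ?thesis using m(1) by linarith
next
  case False
  \<comment> \<open>Neither predicate has a witness, but equal predicates still have the same
    \<open>LEAST\<close>.\<close>
  then have "P = Q" using QP by auto
  then show ?thesis by simp
qed

lemma length_function_eq_min_saturating_size:
  assumes "R \<ge> 2" "r > 0"
  shows "length_function TYPE('a::{field,finite}) r R = min_saturating_size TYPE('a) (r - 1) (R - 1)"
proof -
  let ?P = "\<lambda>n. \<exists>xs :: 'a vec list. length xs = n \<and> set xs \<subseteq> carrier_vec r \<and> exact_cover r R (set xs)"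
  let ?Q = "\<lambda>n. \<exists>S :: 'a vec set set. saturating (r - 1) (R - 1) S \<and> card S = n"
  have QP: "?P n" if Q: "?Q n" for n
  proof -
    obtain X :: "'a vec set" where X: "X \<subseteq> carrier_vec r" "exact_cover r R X" "card X = n"
      using saturating_exact[OF _ assms] Q by metis
    from X(1) card_carrier_vec(1) have "finite X" by (rule finite_subset)
    from finite_distinct_list[OF this] obtain xs where xs: "set xs = X" "distinct xs" by (elim exE conjE)
    then have "length xs = n" using distinct_card[OF xs(2)] X(3) by simp
    then show ?thesis using X(1,2) xs(1) by (intro exI[of _ xs]) simp
  qed
  have PQ: "\<exists>m\<le>n. ?Q m" if P: "?P n" for n
  proof -
    from P obtain xs :: "'a vec list" where xs: "length xs = n" "set xs \<subseteq> carrier_vec r" "exact_cover r R (set xs)"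
      by (elim exE conjE)
    obtain S :: "'a vec set set" where "saturating (r - 1) (R - 1) S" "card S \<le> card (set xs)"
      using exact_saturating[OF xs(2,3) assms] by (elim exE conjE)
    moreover from this(2) have "card S \<le> n" using card_length[of xs] xs(1) by simp
    ultimately show ?thesis by (intro exI[of _ "card S"] conjI exI[of _ S] refl)
  qed
  have "Least ?P = Least ?Q" by (rule Least_eq_if_interleaved) (fact QP PQ)+
  then show ?thesis unfolding length_function_def min_saturating_size_def
    using assms by (subst length_code_iff) auto
qed

lemma length_function_le:
  fixes X :: "'a::{field,finite} vec set"
  assumes "X \<subseteq> carrier_vec r" "exact_cover r R X" "R > 0"
  shows "length_function TYPE('a) r R \<le> card X"
proof -
  from assms(1) card_carrier_vec(1) have "finite X" by (rule finite_subset)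
  from finite_distinct_list[OF this] obtain xs where xs: "set xs = X" "distinct xs" by (elim exE conjE)
  then have "length xs = card X" using distinct_card[OF xs(2)] by simp
  then show ?thesis unfolding length_function_def length_code_iff[OF assms(3)]
    using assms(1,2) xs(1) by (intro Least_le exI[of _ xs]) simp
qed

section \<open>Attaining the covering radius exactly\<close>

lemma vspan_remove:
  fixes A :: "'a::field vec set"
  assumes A: "finite A" "A \<subseteq> carrier_vec r" and b: "b \<in> A" and x: "x \<in> vspan r A"
  shows "\<exists>c. x - c \<cdot>\<^sub>v b \<in> vspan r (A - {b})"
proof -
  have bC: "b \<in> carrier_vec r" using A(2) b by (rule subsetD)
  from x obtain c where c: "x \<in> carrier_vec r" "\<forall>i<r. x $ i = (\<Sum>a\<in>A. c a * a $ i)"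
    unfolding vspan_iff[OF A] by (elim conjE exE)
  have "\<forall>i<r. (x - c b \<cdot>\<^sub>v b) $ i = (\<Sum>a\<in>A - {b}. c a * a $ i)"
    using c bC A(1) b by (simp add: sum.remove[of A b])
  moreover have "x - c b \<cdot>\<^sub>v b \<in> carrier_vec r" using c(1) bC by simp
  moreover have A': "finite (A - {b})" "A - {b} \<subseteq> carrier_vec r"
    using A(1) order_trans[OF Diff_subset A(2)] by simp_all
  ultimately have "x - c b \<cdot>\<^sub>v b \<in> vspan r (A - {b})"
    unfolding vspan_iff[OF A'] by (intro conjI exI[of _ c])
  then show ?thesis by (rule exI)
qed

text \<open>\<open>x\<close> is the sum of the new vector and a multiple of \<open>b\<close>, which
  stays available. So a combination that uses \<open>x\<close> needs at most one more
  vector.\<close>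

lemma covers_exchange:
  fixes Z :: "'a::{field,finite} vec set"
  assumes cov: "covers r k (insert x Z)" and Z: "Z \<subseteq> carrier_vec r" and x: "x \<in> carrier_vec r" and b: "b \<in> Z"
  shows "covers r (Suc k) (insert (x - c \<cdot>\<^sub>v b) Z)"
  unfolding covers_def
proof
  fix v :: "'a vec" assume "v \<in> carrier_vec r"
  with cov obtain B where B: "B \<subseteq> insert x Z" "card B \<le> k" "v \<in> vspan r B" by (rule coversE)
  have bC: "b \<in> carrier_vec r" using Z b by (rule subsetD)
  define y where "y = x - c \<cdot>\<^sub>v b"
  have yC: "y \<in> carrier_vec r" using x bC unfolding y_def by simp
  define B' where "B' = insert y (insert b (B - {x}))"
  have finB: "finite B"
    by (rule finite_subset[OF B(1)], rule finite_subset[of _ "carrier_vec r"]) (use x Z card_carrier_vec(1) in simp_all)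
  have "B - {x} \<subseteq> Z" using B(1) by auto
  then have B'Z: "B' \<subseteq> insert y Z" unfolding B'_def using b by auto
  then have B'C: "B' \<subseteq> carrier_vec r" using yC Z by (meson insert_subset subset_trans)
  show "\<exists>B\<subseteq>insert (x - c \<cdot>\<^sub>v b) Z. card B \<le> Suc k \<and> v \<in> vspan r B"
  proof (cases "x \<in> B")
    case True
    have "card (B - {x}) < card B" using finB True by (rule card_Diff1_less)
    moreover have "card B' \<le> Suc (Suc (card (B - {x})))"
      unfolding B'_def using finB by (simp add: card_insert_if)
    ultimately have card: "card B' \<le> Suc k" using B(2) by simp
    have "y \<in> vspan r B'" "b \<in> vspan r B'"
      by (rule subsetD[OF vspan_base[OF B'C]], simp add: B'_def)+
    then have "y + c \<cdot>\<^sub>v b \<in> vspan r B'" by (intro vspan_add vspan_smult B'C)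
    also have "y + c \<cdot>\<^sub>v b = x" using x bC unfolding y_def by (intro eq_vecI) simp_all
    finally have xB': "x \<in> vspan r B'" .
    have "B \<subseteq> vspan r B'"
    proof
      fix z assume "z \<in> B"
      then show "z \<in> vspan r B'" using xB' subsetD[OF vspan_base[OF B'C], of z]
        by (cases "z = x") (simp_all add: B'_def)
    qed
    then have "v \<in> vspan r B'" using B(3) by (rule subsetD[OF vspan_minimal[OF B'C]])
    then show ?thesis using B'Z card by (intro exI[of _ B']) (simp add: y_def)
  next
    case False
    then have "B \<subseteq> insert (x - c \<cdot>\<^sub>v b) Z" using B(1) by auto
    then show ?thesis using B by (intro exI[of _ B]) simp
  qed
qed

text \<open>A minimal spanning set is a basis, and the sum of all its vectors is not a combination
  of fewer.\<close>

lemma not_covers_minimal: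
  fixes W :: "'a::{field,finite} vec set"
  assumes W: "W \<subseteq> carrier_vec r" "vspan r W = carrier_vec r"
    and minimal: "\<And>V. V \<subset> W \<Longrightarrow> vspan r V \<noteq> carrier_vec r"
    and k: "k < r"
  shows "\<not> covers r k W"
proof
  assume cov: "covers r k W"
  have finW: "finite W" using W(1) card_carrier_vec(1) by (rule finite_subset)
  have "r \<le> card W"
  proof -
    interpret vec_space "TYPE('a)" r .
    show ?thesis using gen_ge_dim[OF finW] W dim_is_n by simp
  qed
  define v where "v = vec r (\<lambda>i. \<Sum>w\<in>W. w $ i)"
  have "v \<in> carrier_vec r" unfolding v_def by simp
  with cov obtain B where B: "B \<subseteq> W" "card B \<le> k" "v \<in> vspan r B" by (rule coversE)
  have "B \<noteq> W" using B(2) k \<open>r \<le> card W\<close> by auto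
  with B(1) obtain b where b: "b \<in> W" "b \<notin> B" by auto
  have finB: "finite B" and BC: "B \<subseteq> carrier_vec r"
    using finite_subset[OF B(1) finW] subset_trans[OF B(1) W(1)] by simp_all
  from B(3) obtain c where c: "\<forall>i<r. v $ i = (\<Sum>a\<in>B. c a * a $ i)" unfolding vspan_iff[OF finB BC] by (elim conjE exE)
  \<comment> \<open>The representation of \<open>v\<close> by \<open>B\<close>, which lacks
    \<open>b\<close>, is equated with the sum over \<open>W\<close> and solved for
    \<open>b\<close>.\<close>
  define d where "d = (\<lambda>w. (if w \<in> B then c w else 0) - 1)"
  have WC: "finite (W - {b})" "W - {b} \<subseteq> carrier_vec r" using finW order_trans[OF Diff_subset W(1)] by simp_all
  have "b $ i = (\<Sum>a\<in>W - {b}. d a * a $ i)" if i: "i < r" for i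
  proof -
    have "(\<Sum>a\<in>W - {b}. d a * a $ i) = (\<Sum>a\<in>W - {b}. (if a \<in> B then c a * a $ i else 0)) - (\<Sum>a\<in>W - {b}. a $ i)"
      unfolding d_def sum_subtractf[symmetric] by (rule sum.cong) (simp_all add: algebra_simps)
    also have "(\<Sum>a\<in>W - {b}. (if a \<in> B then c a * a $ i else 0)) = (\<Sum>a\<in>B. c a * a $ i)"
      using WC(1) B(1) b by (intro sum.mono_neutral_cong_right) auto
    also have "\<dots> = (\<Sum>a\<in>W. a $ i)" using c i unfolding v_def by simp
    also have "\<dots> = b $ i + (\<Sum>a\<in>W - {b}. a $ i)" using finW b(1) by (rule sum.remove)
    finally show ?thesis by simp
  qed
  moreover have "b \<in> carrier_vec r" using W(1) b(1) by (rule subsetD)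
  ultimately have bsp: "b \<in> vspan r (W - {b})" unfolding vspan_iff[OF WC] by (intro conjI exI[of _ d]) simp_all
  have "W \<subseteq> vspan r (W - {b})"
  proof
    fix w assume "w \<in> W"
    then show "w \<in> vspan r (W - {b})" using bsp subsetD[OF vspan_base[OF WC(2)], of w] by (cases "w = b") simp_all
  qed
  then have "vspan r W \<subseteq> vspan r (W - {b})" by (rule vspan_minimal[OF WC(2)])
  then have "vspan r (W - {b}) = carrier_vec r" using W(2) vspan_carrier[OF WC(2)] by simp
  moreover have "W - {b} \<subset> W" using b(1) by auto
  ultimately show False using minimal by simp
qed

text \<open>For a basis \<open>W\<close> the number of nonzero coordinates of \<open>x\<close>. It
  measures how far \<open>x\<close> still is from being zero.\<close>

definition weight :: "nat \<Rightarrow> 'a::field vec set \<Rightarrow> 'a vec \<Rightarrow> nat" where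
  "weight r W x = (LEAST k. \<exists>A\<subseteq>W. card A = k \<and> x \<in> vspan r A)"

text \<open>
  A discrete intermediate value argument: replacing a column \<open>x\<close> by \<open>x - c b\<close> with another column
  \<open>b\<close> changes the covering radius by at most one, and such steps lead to the columns of a basis,
  whose covering radius is \<open>r\<close>.
\<close>

lemma exists_exact_cover_aux:
  fixes X :: "'a::{field,finite} vec set"
  assumes W: "vspan r W = carrier_vec r" "\<And>V. V \<subset> W \<Longrightarrow> vspan r V \<noteq> carrier_vec r"
    and R: "0 < R" "R \<le> r"
    and "W \<subseteq> X" "X \<subseteq> carrier_vec r" "covers r (R - 1) X"
  shows "\<exists>Y \<subseteq> (carrier_vec r :: 'a vec set). exact_cover r R Y \<and> card Y \<le> card X"
  using assms(5-)
\<comment> \<open>Each vector outside \<open>W\<close> counts its weight plus one; the extra one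
  lets the measure drop when a vector of weight 0 is removed.\<close>
proof (induction "\<Sum>x\<in>X - W. Suc (weight r W x)" arbitrary: X rule: less_induct)
  case less
  have finX: "finite X" using less.prems(2) card_carrier_vec(1) by (rule finite_subset)
  have WC: "W \<subseteq> carrier_vec r" using less.prems(1,2) by (rule subset_trans)
  have finW: "finite W" using less.prems(1) finX by (rule finite_subset)
  have "\<not> covers r (R - 1) W" by (rule not_covers_minimal[OF WC W]) (use R in simp_all)
  then have "X \<noteq> W" using less.prems(3) by auto
  then obtain x where x: "x \<in> X" "x \<notin> W" using less.prems(1) by auto
  define Z where "Z = X - {x}"
  have Z: "W \<subseteq> Z" "Z \<subseteq> carrier_vec r" "X = insert x Z" "x \<notin> Z"
    using less.prems(1) x order_trans[OF Diff_subset less.prems(2)] unfolding Z_def by auto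
  have finZ: "finite Z" using finX unfolding Z_def by simp
  have cardX: "card X = Suc (card Z)" using Z(3,4) finZ by simp
  have xC: "x \<in> carrier_vec r" using less.prems(2) x(1) by (rule subsetD)
  have \<mu>: "(\<Sum>x\<in>X - W. Suc (weight r W x)) = Suc (weight r W x) + (\<Sum>x\<in>Z - W. Suc (weight r W x))"
  proof -
    have "X - W = insert x (Z - W)" using Z(3) x(2) by auto
    then show ?thesis using finZ Z(4) by simp
  qed
  have ex: "\<exists>k. \<exists>A\<subseteq>W. card A = k \<and> x \<in> vspan r A" using W(1) xC by auto
  from LeastI_ex[OF ex] obtain A where A: "A \<subseteq> W" "card A = weight r W x" "x \<in> vspan r A"
    unfolding weight_def by (elim exE conjE)
  have finA: "finite A" using A(1) finW by (rule finite_subset)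
  have AC: "A \<subseteq> carrier_vec r" using A(1) WC by (rule subset_trans)
  show ?case
  proof (cases "A = {}")
    case True
    have "covers r (R - 1) Z" unfolding covers_def
    proof
      fix v :: "'a vec" assume "v \<in> carrier_vec r"
      with less.prems(3) obtain B where B: "B \<subseteq> X" "card B \<le> R - 1" "v \<in> vspan r B" by (rule coversE)
      have finB: "finite B" using B(1) finX by (rule finite_subset)
      have BZ: "B - {x} \<subseteq> Z" using B(1) unfolding Z_def by auto
      then have BC: "B - {x} \<subseteq> carrier_vec r" using Z(2) by (rule subset_trans)
      have "B \<subseteq> vspan r (B - {x})"
      proof
        fix z assume "z \<in> B"
        moreover have "x \<in> vspan r (B - {x})" using A(3) vspan_mono[of "{}" "B - {x}" r] True by (simp add: subsetD)
        ultimately show "z \<in> vspan r (B - {x})" using subsetD[OF vspan_base[OF BC], of z] by (cases "z = x") simp_all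
      qed
      then have "v \<in> vspan r (B - {x})" using B(3) by (rule subsetD[OF vspan_minimal[OF BC]])
      moreover have "card (B - {x}) \<le> R - 1" using card_mono[OF finB Diff_subset, of "{x}"] B(2) by simp
      ultimately show "\<exists>B\<subseteq>Z. card B \<le> R - 1 \<and> v \<in> vspan r B" using BZ by (intro exI[of _ "B - {x}"]) simp
    qed
    from less.hyps[OF _ Z(1,2) this] obtain Y :: "'a vec set"
      where "Y \<subseteq> carrier_vec r" "exact_cover r R Y" "card Y \<le> card Z" unfolding \<mu> by auto
    then show ?thesis using cardX by (intro exI[of _ Y]) simp
  next
    case False
    then obtain b where b: "b \<in> A" by auto
    from vspan_remove[OF finA AC b A(3)] obtain c where c: "x - c \<cdot>\<^sub>v b \<in> vspan r (A - {b})" by (rule exE)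
    define y where "y = x - c \<cdot>\<^sub>v b"
    define X' where "X' = insert y Z"
    have bZ: "b \<in> Z" using b A(1) Z(1) by auto
    have bC: "b \<in> carrier_vec r" using Z(2) bZ by (rule subsetD)
    have X': "X' \<subseteq> carrier_vec r" using Z(2) xC bC unfolding X'_def y_def by simp
    \<comment> \<open>The exchange raises the count from \<open>R - 1\<close> to at most
      \<open>R\<close>. Either \<open>R\<close> is now the exact value, or the induction continues
      with a smaller measure.\<close>
    have cov: "covers r R X'"
      using covers_exchange[OF less.prems(3)[unfolded Z(3)] Z(2) xC bZ, of c] R(1) unfolding X'_def y_def by simp
    have cardX': "card X' \<le> card X" unfolding X'_def cardX using finZ by (simp add: card_insert_if)
    show ?thesis
    proof (cases "covers r (R - 1) X'")
      case True
      have "weight r W y \<le> card (A - {b})" unfolding weight_def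
        by (rule Least_le, rule exI[of _ "A - {b}"]) (use A(1) c in \<open>auto simp: y_def\<close>)
      also have "\<dots> < weight r W x" unfolding A(2)[symmetric] using finA b by (rule card_Diff1_less)
      finally have w: "weight r W y < weight r W x" .
      have "(\<Sum>x\<in>X' - W. Suc (weight r W x)) \<le> (\<Sum>x\<in>insert y (Z - W). Suc (weight r W x))"
        using finZ unfolding X'_def by (intro sum_mono2) auto
      also have "\<dots> \<le> Suc (weight r W y) + (\<Sum>x\<in>Z - W. Suc (weight r W x))"
        using finZ by (simp add: sum.insert_if)
      also have "\<dots> < (\<Sum>x\<in>X - W. Suc (weight r W x))" unfolding \<mu> using w by simp
      finally have lt: "(\<Sum>x\<in>X' - W. Suc (weight r W x)) < (\<Sum>x\<in>X - W. Suc (weight r W x))" .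
      have "W \<subseteq> X'" using Z(1) unfolding X'_def by auto
      from less.hyps[OF lt this X' True] obtain Y :: "'a vec set"
        where "Y \<subseteq> carrier_vec r" "exact_cover r R Y" "card Y \<le> card X'" by (elim exE conjE)
      then show ?thesis using cardX' by (intro exI[of _ Y]) simp
    next
      case False
      then show ?thesis using cov X' cardX' by (intro exI[of _ X']) (simp add: exact_cover_def)
    qed
  qed
qed

lemma exists_exact_cover:
  fixes X :: "'a::{field,finite} vec set"
  assumes X: "X \<subseteq> carrier_vec r" and cov: "covers r R X" and R: "0 < R" "R \<le> r"
  shows "\<exists>Y \<subseteq> (carrier_vec r :: 'a vec set). exact_cover r R Y \<and> card Y \<le> card X"
proof (cases "covers r (R - 1) X")
  case True
  have finX: "finite X" using X card_carrier_vec(1) by (rule finite_subset)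
  define \<W> where "\<W> = {W \<in> Pow X. vspan r W = carrier_vec r}"
  have "finite \<W>" "X \<in> \<W>" using finX covers_imp_vspan[OF cov X] unfolding \<W>_def by simp_all
  then obtain W where W: "W \<in> \<W>" "\<And>V. V \<in> \<W> \<Longrightarrow> V \<subseteq> W \<Longrightarrow> V = W"
    using finite_has_minimal[of \<W>] by auto
  have "vspan r V \<noteq> carrier_vec r" if "V \<subset> W" for V
    using W(1) W(2)[of V] that unfolding \<W>_def by auto
  moreover have "W \<subseteq> X" "vspan r W = carrier_vec r" using W(1) unfolding \<W>_def by auto
  ultimately show ?thesis using R X True by (intro exists_exact_cover_aux[of r W R X])
next
  case False
  then show ?thesis using X cov by (intro exI[of _ X]) (simp add: exact_cover_def)
qed

text \<open>This leaves only an upper bound on the covering radius to be shown for the constructions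
  below.\<close>

corollary length_function_le_covers:
  fixes X :: "'a::{field,finite} vec set"
  assumes "X \<subseteq> carrier_vec r" "covers r R X" "0 < R" "R \<le> r"
  shows "length_function TYPE('a) r R \<le> card X"
proof -
  from exists_exact_cover[OF assms] obtain Y :: "'a vec set"
    where Y: "Y \<subseteq> carrier_vec r" "exact_cover r R Y" "card Y \<le> card X" by (elim exE conjE)
  from length_function_le[OF Y(1,2) assms(3)] Y(3) show ?thesis by simp
qed

section \<open>The point sets and their lifts\<close>

text \<open>The points of all blocks are collected as pairs of a block number and a parameter.
  Numbering from \<open>s\<close> lets the induction shift the blocks; a pair contributes to the
  second coordinates of its own and the next block.\<close>

lemma chain_combination:
  assumes "chain (block f) b w"
  shows "\<exists>J c. J \<subseteq> {s..<s + length w} \<times> UNIV \<and> finite J \<and> card J = b \<and> (\<forall>p\<in>J. c p \<noteq> 0) \<and>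
    (\<forall>i<length w. (\<Sum>p\<in>J. if fst p = s + i then c p else 0) = fst (w ! i) \<and>
      (\<Sum>p\<in>J. (if fst p = s + i then c p * snd p else 0) +
        (if Suc (fst p) = s + i then c p * f (snd p) else 0)) = snd (w ! i))"
  using assms
proof (induction arbitrary: s rule: chain.induct)
  case Nil
  then show ?case by (intro exI[of _ "{}"]) simp
next
  case (Cons n u \<tau> \<sigma> b w)
  from Cons.hyps(1) obtain A a where A: "finite A" "card A = n" "\<forall>t\<in>A. a t \<noteq> 0"
    "(\<Sum>t\<in>A. a t) = u" "(\<Sum>t\<in>A. a t * t) = \<tau>" "(\<Sum>t\<in>A. a t * f t) = \<sigma>"
    unfolding block_def by (elim exE conjE)
  from Cons.IH[of "Suc s"] obtain J c where J: "J \<subseteq> {Suc s..<Suc s + length w} \<times> UNIV" "finite J" "card J = b" "\<forall>p\<in>J. c p \<noteq> 0"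
    and sums: "\<And>i. i < length w \<Longrightarrow> (\<Sum>p\<in>J. if fst p = Suc s + i then c p else 0) = fst (lower \<sigma> w ! i)"
      "\<And>i. i < length w \<Longrightarrow> (\<Sum>p\<in>J. (if fst p = Suc s + i then c p * snd p else 0) +
        (if Suc (fst p) = Suc s + i then c p * f (snd p) else 0)) = snd (lower \<sigma> w ! i)"
    by auto
  define L where "L = {s} \<times> A"
  define d where "d = (\<lambda>p. if fst p = s then a (snd p) else c p)"
  have fst_J: "fst p \<ge> Suc s" if "p \<in> J" for p using J(1) that by auto
  have L: "finite L" "card L = n" using A(1,2) unfolding L_def by (simp_all add: card_cartesian_product)
  have disj: "L \<inter> J = {}" using fst_J unfolding L_def by fastforce
  have dJ: "d p = c p" "fst p \<noteq> s" "Suc (fst p) \<noteq> s" if "p \<in> J" for p using fst_J[OF that] unfolding d_def by auto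
  have sum_L: "(\<Sum>p\<in>L. h p) = (\<Sum>t\<in>A. h (s, t))" for h :: "nat \<times> 'a \<Rightarrow> 'a"
  proof -
    have "L = Pair s ` A" unfolding L_def by auto
    then show ?thesis by (simp add: sum.reindex inj_on_def)
  qed
  have split: "(\<Sum>p\<in>L \<union> J. h p) = (\<Sum>t\<in>A. h (s, t)) + (\<Sum>p\<in>J. h p)" for h :: "nat \<times> 'a \<Rightarrow> 'a"
    using sum.union_disjoint[OF L(1) J(2) disj, of h] sum_L[of h] by simp
  have lower_nth: "fst (lower \<sigma> w ! i) = fst (w ! i)" "snd (lower \<sigma> w ! i) = snd (w ! i) - (if i = 0 then \<sigma> else 0)" if "i < length w" for i
    using that by (cases "(\<sigma>, w)" rule: lower.cases; cases i; simp)+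
  have "(\<Sum>p\<in>L \<union> J. if fst p = s + i then d p else 0) = fst (((u, \<tau>) # w) ! i)" if "i < Suc (length w)" for i
  proof (cases i)
    case 0
    have "(\<Sum>p\<in>J. if fst p = s then d p else 0) = 0" using dJ by (intro sum.neutral) auto
    then show ?thesis unfolding split using A(4) 0 by (simp add: d_def)
  next
    case (Suc k)
    have "(\<Sum>p\<in>J. if fst p = s + i then d p else 0) = (\<Sum>p\<in>J. if fst p = Suc s + k then c p else 0)"
      using dJ Suc by (intro sum.cong) auto
    then show ?thesis unfolding split using sums(1)[of k] lower_nth(1)[of k] Suc that by simp
  qed
  moreover have "(\<Sum>p\<in>L \<union> J. (if fst p = s + i then d p * snd p else 0) + (if Suc (fst p) = s + i then d p * f (snd p) else 0))
    = snd (((u, \<tau>) # w) ! i)" if "i < Suc (length w)" for i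
  proof (cases i)
    case 0
    have "(\<Sum>p\<in>J. (if fst p = s + i then d p * snd p else 0) + (if Suc (fst p) = s + i then d p * f (snd p) else 0)) = 0"
      using dJ 0 by (intro sum.neutral) auto
    then show ?thesis unfolding split using A(5) 0 by (simp add: d_def)
  next
    case (Suc k)
    have "(\<Sum>p\<in>J. (if fst p = s + i then d p * snd p else 0) + (if Suc (fst p) = s + i then d p * f (snd p) else 0))
      = (\<Sum>p\<in>J. (if fst p = Suc s + k then c p * snd p else 0) + (if Suc (fst p) = Suc s + k then c p * f (snd p) else 0))"
      using dJ Suc by (intro sum.cong) auto
    then show ?thesis unfolding split using sums(2)[of k] lower_nth(2)[of k] Suc that A(6) by (simp add: d_def)
  qed
  moreover have "L \<union> J \<subseteq> {s..<s + length ((u, \<tau>) # w)} \<times> UNIV"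
    using J(1) unfolding L_def by auto
  moreover have "card (L \<union> J) = n + b" using card_Un_disjoint[OF L(1) J(2) disj] L(2) J(3) by simp
  moreover have "\<forall>p\<in>L \<union> J. d p \<noteq> 0"
  proof
    fix p assume "p \<in> L \<union> J"
    then show "d p \<noteq> 0"
    proof
      assume "p \<in> L"
      then show ?thesis using A(3) unfolding L_def d_def by auto
    next
      assume "p \<in> J"
      then show ?thesis using J(4) dJ(1) by simp
    qed
  qed
  ultimately show ?case using L(1) J(2) by (intro exI[of _ "L \<union> J"] exI[of _ d]) simp
qed

section \<open>The point set\<close>

text \<open>
  \<open>Some (i, t)\<close> is the point \<open>U\<^sub>i + t T\<^sub>i + f(t) T\<^sub>i\<^sub>+\<^sub>1\<close>, where \<open>T\<^sub>R = 0\<close>, and \<open>None\<close> is \<open>T\<^sub>0\<close>.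
\<close>

type_synonym 'a point = "(nat \<times> 'a) option"

definition points :: "nat \<Rightarrow> 'a point set" where
  "points R = insert None (Some ` ({..<R} \<times> UNIV))"

definition ucoord :: "'a::field point \<Rightarrow> nat \<Rightarrow> 'a" where
  "ucoord j k = (case j of None \<Rightarrow> 0 | Some (i, t) \<Rightarrow> if i = k then 1 else 0)"

definition tcoord :: "('a::field \<Rightarrow> 'a) \<Rightarrow> 'a point \<Rightarrow> nat \<Rightarrow> 'a" where
  "tcoord f j k = (case j of None \<Rightarrow> if k = 0 then 1 else 0
     | Some (i, t) \<Rightarrow> (if i = k then t else 0) + (if Suc i = k then f t else 0))"

lemma points_finite:
  "finite (points R :: 'a::finite point set)"
  "card (points R :: 'a::finite point set) = R * card (UNIV :: 'a set) + 1"
proof -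
  have "card (Some ` ({..<R} \<times> (UNIV :: 'a set))) = R * card (UNIV :: 'a set)"
    by (subst card_image) (simp_all add: card_cartesian_product)
  then show "card (points R :: 'a::finite point set) = R * card (UNIV :: 'a set) + 1"
    unfolding points_def by (subst card_insert_disjoint) auto
qed (simp add: points_def)

text \<open>\<open>e\<close> becomes the coefficient of \<open>T\<^sub>0\<close>, which is included
  only if \<open>e\<close> is nonzero; hence the two counts.\<close>

lemma points_combination:
  assumes "chain (block f) b (lower e (map (\<lambda>i. (u i, \<tau> i)) [0..<R]))" and R: "R > 0"
  shows "\<exists>J c. J \<subseteq> points R \<and> finite J \<and> card J = (if e = 0 then b else Suc b) \<and> (\<forall>j\<in>J. c j \<noteq> 0) \<and>
    (\<forall>k<R. (\<Sum>j\<in>J. c j * ucoord j k) = u k \<and> (\<Sum>j\<in>J. c j * tcoord f j k) = \<tau> k)"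
proof -
  define w where "w = map (\<lambda>i. (u i, \<tau> i)) [0..<R]"
  have len: "length w = R" unfolding w_def by simp
  have nth: "fst (lower e w ! k) = u k" "snd (lower e w ! k) = \<tau> k - (if k = 0 then e else 0)" if "k < R" for k
  proof -
    obtain R' where R': "R = Suc R'" using R by (cases R) auto
    have "w = (u 0, \<tau> 0) # map (\<lambda>i. (u (Suc i), \<tau> (Suc i))) [0..<R']"
      unfolding w_def R' by (simp add: upt_conv_Cons map_Suc_upt[symmetric] del: upt_Suc)
    then show "fst (lower e w ! k) = u k" "snd (lower e w ! k) = \<tau> k - (if k = 0 then e else 0)"
      using that R' by (cases k; simp)+
  qed
  from chain_combination[OF assms(1)[folded w_def], of 0] obtain J c
    where J: "J \<subseteq> {..<R} \<times> UNIV" "finite J" "card J = b" "\<forall>p\<in>J. c p \<noteq> 0"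
    and sums: "\<And>k. k < R \<Longrightarrow> (\<Sum>p\<in>J. if fst p = k then c p else 0) = u k"
      "\<And>k. k < R \<Longrightarrow> (\<Sum>p\<in>J. (if fst p = k then c p * snd p else 0) + (if Suc (fst p) = k then c p * f (snd p) else 0))
        = \<tau> k - (if k = 0 then e else 0)"
    using nth by (auto simp: len lessThan_atLeast0)
  define N :: "'a point set" where "N = (if e = 0 then {} else {None})"
  define d where "d j = (case j of None \<Rightarrow> e | Some p \<Rightarrow> c p)" for j
  have fin: "finite N" "finite (Some ` J)" "N \<inter> Some ` J = {}" using J(2) unfolding N_def by auto
  have split: "(\<Sum>j\<in>N \<union> Some ` J. d j * h j) = e * h None + (\<Sum>p\<in>J. c p * h (Some p))" for h :: "'a point \<Rightarrow> 'a"
    unfolding sum.union_disjoint[OF fin] by (simp add: N_def d_def sum.reindex)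
  have "(\<Sum>j\<in>N \<union> Some ` J. d j * ucoord j k) = u k" if "k < R" for k
  proof -
    have "(\<Sum>p\<in>J. c p * ucoord (Some p) k) = (\<Sum>p\<in>J. if fst p = k then c p else 0)"
      by (rule sum.cong) (auto simp: ucoord_def)
    then show ?thesis unfolding split using sums(1)[OF that] by (simp add: ucoord_def)
  qed
  moreover have "(\<Sum>j\<in>N \<union> Some ` J. d j * tcoord f j k) = \<tau> k" if "k < R" for k
  proof -
    have "(\<Sum>p\<in>J. c p * tcoord f (Some p) k) =
      (\<Sum>p\<in>J. (if fst p = k then c p * snd p else 0) + (if Suc (fst p) = k then c p * f (snd p) else 0))"
      by (rule sum.cong) (auto simp: tcoord_def algebra_simps)
    then show ?thesis unfolding split using sums(2)[OF that] by (simp add: tcoord_def)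
  qed
  moreover have "card (N \<union> Some ` J) = (if e = 0 then b else Suc b)"
    unfolding card_Un_disjoint[OF fin] using J(3) by (simp add: N_def card_image)
  moreover have "N \<union> Some ` J \<subseteq> points R" using J(1) unfolding N_def points_def by auto
  moreover have "\<forall>j\<in>N \<union> Some ` J. d j \<noteq> 0" using J(4) unfolding N_def d_def by auto
  ultimately show ?thesis using fin by (intro exI[of _ "N \<union> Some ` J"] exI[of _ d]) simp
qed

lemma points_cover:
  fixes u \<tau> :: "nat \<Rightarrow> 'a::{field,finite}"
  assumes q: "card (UNIV :: 'a set) \<ge> 4" and R: "R > 0"
  shows "\<exists>J c. J \<subseteq> points R \<and> finite J \<and> card J \<le> R \<and>
    (\<forall>k<R. (\<Sum>j\<in>J. c j * ucoord j k) = u k \<and> (\<Sum>j\<in>J. c j * tcoord (\<lambda>t. t * t) j k) = \<tau> k)"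
proof -
  let ?w = "map (\<lambda>i. (u i, \<tau> i)) [0..<R]"
  let ?op = "block (\<lambda>t :: 'a. t * t)"
  have third: "\<exists>y :: 'a. y \<noteq> 0 \<and> y \<noteq> x" for x
  proof -
    have "card {0, x} \<le> 2" by (simp add: card_insert_if)
    then show ?thesis using exists_avoiding[of "{0, x}"] q by auto
  qed
  have op1: "\<exists>\<sigma>. ?op 1 u \<tau> \<sigma>" if "u \<noteq> 0" for u \<tau> :: 'a
    using block_1[OF that, of "\<lambda>t. t * t" "\<tau> / u"] that by (intro exI[of _ "u * (\<tau> / u * (\<tau> / u))"]) simp
  have "cover ?op (length ?w) ?w \<or> (\<exists>e b. b + 1 \<le> length ?w \<and> chain ?op b (lower e ?w))"
    by (rule chain_cover_top[of ?op])
      (fact block_0 op1 block_square_2[OF _ q] block_square_2' block_square_3[OF _ q] third)+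
  then consider b where "b \<le> R" "chain ?op b (lower 0 ?w)" | b e where "Suc b \<le> R" "chain ?op b (lower e ?w)"
    unfolding cover_def by auto
  then obtain e b where eb: "chain ?op b (lower e ?w)" "(if e = 0 then b else Suc b) \<le> R"
  proof cases
    case (1 b)
    then show thesis using that[of b 0] by simp
  next
    case (2 b e)
    then show thesis using that[of b e] by simp
  qed
  from points_combination[OF eb(1) R] obtain J c where "J \<subseteq> points R" "finite J" "card J = (if e = 0 then b else Suc b)"
    "\<forall>k<R. (\<Sum>j\<in>J. c j * ucoord j k) = u k \<and> (\<Sum>j\<in>J. c j * tcoord (\<lambda>t. t * t) j k) = \<tau> k"
    by (elim exE conjE)
  then show ?thesis using eb(2) by (intro exI[of _ J] exI[of _ c]) simp
qed

text \<open>This is the input for the lift: the \<open>R\<close> equations for the new coordinates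
  need \<open>R\<close> points, and a point can adjust these coordinates only through a nonzero
  coefficient.\<close>

lemma points_exact:
  assumes q: "card (UNIV :: 'a::{field,finite} set) \<ge> 7" and R: "R \<ge> 4"
  shows "\<exists>f :: 'a \<Rightarrow> 'a. \<forall>u \<tau>. \<exists>J c. J \<subseteq> points R \<and> finite J \<and> card J = R \<and> (\<forall>j\<in>J. c j \<noteq> 0) \<and>
    (\<forall>k<R. (\<Sum>j\<in>J. c j * ucoord j k) = u k \<and> (\<Sum>j\<in>J. c j * tcoord f j k) = \<tau> k)"
proof -
  obtain f :: "'a \<Rightarrow> 'a" where f: "\<And>u \<tau> \<sigma>. u \<noteq> 0 \<or> \<tau> \<noteq> 0 \<Longrightarrow> block f 2 u \<tau> \<sigma>"
    "\<And>n u \<tau> \<sigma>. 3 \<le> n \<Longrightarrow> n \<le> 6 \<Longrightarrow> block f n u \<tau> \<sigma>"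
  proof (cases "card (UNIV :: 'a set) = 7")
    case True
    from block_function_7[OF this] that show thesis by metis
  next
    case False
    with q have "card (UNIV :: 'a set) \<ge> 8" by simp
    from block_function_large[OF this] that show thesis by metis
  qed
  have op1: "\<exists>\<sigma>. block f 1 u \<tau> \<sigma>" if "u \<noteq> 0" for u \<tau> :: 'a
    using block_1[OF that, of f "\<tau> / u"] that by (intro exI[of _ "u * f (\<tau> / u)"]) simp
  have "\<exists>J c. J \<subseteq> points R \<and> finite J \<and> card J = R \<and> (\<forall>j\<in>J. c j \<noteq> 0) \<and>
    (\<forall>k<R. (\<Sum>j\<in>J. c j * ucoord j k) = u k \<and> (\<Sum>j\<in>J. c j * tcoord f j k) = \<tau> k)" for u \<tau>
  proof -
    let ?w = "map (\<lambda>i. (u i, \<tau> i)) [0..<R]"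
    have "chain (block f) (length ?w) ?w \<or> (\<exists>e. e \<noteq> 0 \<and> chain (block f) (length ?w - 1) (lower e ?w))"
      by (rule chain_exact_top[of "block f"], (fact block_0 op1 f)+) (use R in simp)
    then consider "chain (block f) R (lower 0 ?w)" | e where "e \<noteq> 0" "chain (block f) (R - 1) (lower e ?w)"
      by auto
    then show ?thesis
    proof cases
      case 1
      from points_combination[OF this] R show ?thesis by auto
    next
      case 2
      from points_combination[OF 2(2)] R 2(1) show ?thesis by auto
    qed
  qed
  then show ?thesis by blast
qed

section \<open>From families of vectors to lengths\<close>

lemma vspan_indexed:
  fixes g :: "'i \<Rightarrow> 'a::field vec" and v :: "'a vec"
  assumes J: "finite J" and g: "\<And>j. j \<in> J \<Longrightarrow> g j \<in> carrier_vec r" and v: "v \<in> carrier_vec r"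
    and sum: "\<And>i. i < r \<Longrightarrow> v $ i = (\<Sum>j\<in>J. c j * g j $ i)"
  shows "v \<in> vspan r (g ` J)"
proof -
  have fin: "finite (g ` J)" "g ` J \<subseteq> carrier_vec r" using J g by (simp_all add: image_subset_iff)
  \<comment> \<open>Different indices may give the same vector; their coefficients are added
    up.\<close>
  define d where "d b = (\<Sum>j | j \<in> J \<and> g j = b. c j)" for b
  have "v $ i = (\<Sum>b\<in>g ` J. d b * b $ i)" if "i < r" for i
  proof -
    have "v $ i = (\<Sum>b\<in>g ` J. \<Sum>j | j \<in> J \<and> g j = b. c j * g j $ i)"
      unfolding sum[OF that] by (rule sum.image_gen[OF J])
    also have "\<dots> = (\<Sum>b\<in>g ` J. d b * b $ i)"
      unfolding d_def sum_distrib_right by (intro sum.cong refl) simp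
    finally show ?thesis .
  qed
  then show ?thesis unfolding vspan_iff[OF fin] using v by (intro conjI exI[of _ d]) simp_all
qed

lemma covers_indexed:
  fixes g :: "'i \<Rightarrow> 'a::field vec"
  assumes g: "\<And>j. j \<in> I \<Longrightarrow> g j \<in> carrier_vec r"
    and ex: "\<And>v :: 'a vec. v \<in> carrier_vec r \<Longrightarrow> \<exists>J c. J \<subseteq> I \<and> finite J \<and> card J \<le> k \<and> (\<forall>i<r. v $ i = (\<Sum>j\<in>J. c j * g j $ i))"
  shows "covers r k (g ` I)"
  unfolding covers_def
proof
  fix v :: "'a vec" assume v: "v \<in> carrier_vec r"
  from ex[OF v] obtain J c where J: "J \<subseteq> I" "finite J" "card J \<le> k" "\<forall>i<r. v $ i = (\<Sum>j\<in>J. c j * g j $ i)"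
    by (elim exE conjE)
  have "v \<in> vspan r (g ` J)"
    by (rule vspan_indexed[OF J(2) g v, where c = c]) (use J(1,4) in auto)
  moreover have "card (g ` J) \<le> k" using card_image_le[OF J(2), of g] J(3) by simp
  ultimately show "\<exists>B\<subseteq>g ` I. card B \<le> k \<and> v \<in> vspan r B"
    using image_mono[OF J(1), of g] by (intro exI[of _ "g ` J"]) simp
qed

lemma length_function_double:
  assumes q: "card (UNIV :: 'a::{field,finite} set) \<ge> 4" and R: "R > 0"
  shows "length_function TYPE('a) (2 * R) R \<le> R * card (UNIV :: 'a set) + 1"
proof -
  define g :: "'a point \<Rightarrow> 'a vec" where
    "g j = vec (2 * R) (\<lambda>k. if k < R then ucoord j k else tcoord (\<lambda>t. t * t) j (k - R))" for j
  have "covers (2 * R) R (g ` points R)"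
  proof (rule covers_indexed)
    fix v :: "'a vec" assume "v \<in> carrier_vec (2 * R)"
    from points_cover[OF q R, of "\<lambda>k. v $ k" "\<lambda>k. v $ (R + k)"] obtain J c
      where J: "J \<subseteq> points R" "finite J" "card J \<le> R"
        "\<forall>k<R. (\<Sum>j\<in>J. c j * ucoord j k) = v $ k \<and> (\<Sum>j\<in>J. c j * tcoord (\<lambda>t. t * t) j k) = v $ (R + k)"
      by (elim exE conjE)
    have "v $ i = (\<Sum>j\<in>J. c j * g j $ i)" if "i < 2 * R" for i
      using J(4)[rule_format, of i] J(4)[rule_format, of "i - R"] that unfolding g_def by (cases "i < R") simp_all
    then show "\<exists>J c. J \<subseteq> points R \<and> finite J \<and> card J \<le> R \<and> (\<forall>i<2 * R. v $ i = (\<Sum>j\<in>J. c j * g j $ i))"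
      using J(1-3) by (intro exI[of _ J] exI[of _ c]) simp
  qed (simp add: g_def)
  then have "length_function TYPE('a) (2 * R) R \<le> card (g ` points R)"
    by (intro length_function_le_covers) (use R in \<open>simp_all add: g_def image_subset_iff\<close>)
  also have "\<dots> \<le> R * card (UNIV :: 'a set) + 1"
    using card_image_le[OF points_finite(1), of g R] points_finite(2)[of R, where ?'a = 'a] by simp
  finally show ?thesis .
qed

section \<open>Lifting by an extension field\<close>

text \<open>
  The columns \<open>\<beta>\<^sup>l\<close>, \<open>l < R\<close>, of a Vandermonde matrix; \<open>None\<close> gets the point at infinity, since
  the extension field need not have more than \<open>R q\<close> elements.
\<close>

definition lift_part :: "(nat \<times> 'a \<Rightarrow> 'b) \<Rightarrow> nat \<Rightarrow> 'a point \<Rightarrow> nat \<Rightarrow> 'b \<Rightarrow> 'b::field" where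
  "lift_part \<beta> R j l x = (case j of None \<Rightarrow> if Suc l = R then x else 0 | Some p \<Rightarrow> \<beta> p ^ l * x)"

lemma lift_part_mult: "y * lift_part \<beta> R j l x = lift_part \<beta> R j l (y * x)"
  unfolding lift_part_def by (simp split: option.split)

lemma lift_part_closed:
  fixes \<beta> :: "nat \<times> 'a::{field,finite} \<Rightarrow> 'a alg_closure"
  assumes "range \<beta> \<subseteq> subfield_ac m" "x \<in> subfield_ac m"
  shows "lift_part \<beta> R j l x \<in> subfield_ac m"
proof -
  have "\<beta> p ^ l \<in> subfield_ac m" for p
    by (induction l) (use assms(1) subfield_ac_closed(6)[of "1 :: 'a" m] subfield_ac_closed(4) in auto)
  then show ?thesis
    using assms(2) subfield_ac_closed(6)[of "0 :: 'a" m] unfolding lift_part_def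
    by (auto split: option.split intro: subfield_ac_closed(4))
qed

text \<open>The point at infinity enters only the last equation. If it is in \<open>J\<close>, the
  other \<open>R - 1\<close> points solve the first \<open>R - 1\<close> equations and it corrects
  the last one.\<close>

lemma lift_solution:
  fixes \<beta> :: "nat \<times> 'a::{field,finite} \<Rightarrow> 'a alg_closure"
  assumes J: "J \<subseteq> points R" "finite J" "card J = R" and R: "R > 0"
    and \<beta>: "inj_on \<beta> ({..<R} \<times> UNIV)" "range \<beta> \<subseteq> subfield_ac m"
    and s: "\<And>l. s l \<in> subfield_ac m"
  shows "\<exists>\<eta>. (\<forall>j\<in>J. \<eta> j \<in> subfield_ac m) \<and> (\<forall>l<R. (\<Sum>j\<in>J. lift_part \<beta> R j l (\<eta> j)) = s l)"
proof -
  define J' where "J' = J - {None}"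
  define B where "B = (\<lambda>j. \<beta> (the j))"
  have J': "finite J'" "J' \<subseteq> Some ` ({..<R} \<times> UNIV)" using J(1,2) unfolding J'_def points_def by auto
  have "inj_on B J'"
  proof (rule inj_onI)
    fix x y assume xy: "x \<in> J'" "y \<in> J'" and eq: "B x = B y"
    from subsetD[OF J'(2) xy(1)] obtain p where p: "x = Some p" "p \<in> {..<R} \<times> UNIV" by (rule imageE)
    from subsetD[OF J'(2) xy(2)] obtain p' where p': "y = Some p'" "p' \<in> {..<R} \<times> UNIV" by (rule imageE)
    show "x = y" using inj_onD[OF \<beta>(1) _ p(2) p'(2)] eq unfolding B_def p(1) p'(1) by simp
  qed
  moreover have "B ` J' \<subseteq> subfield_ac m" using \<beta>(2) unfolding B_def by auto
  ultimately obtain \<eta> where \<eta>: "\<forall>j\<in>J'. \<eta> j \<in> subfield_ac m" "\<forall>l<card J'. (\<Sum>j\<in>J'. \<eta> j * B j ^ l) = s l"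
    using vandermonde_solution[OF J'(1), of B m s] s by auto
  have some: "lift_part \<beta> R j l x = x * B j ^ l" if "j \<in> J'" for j l x
    using that J'(2) unfolding lift_part_def B_def by (auto simp: mult.commute)
  show ?thesis
  proof (cases "None \<in> J")
    case False
    then have "J' = J" unfolding J'_def by auto
    then show ?thesis using \<eta> J(3) some by (intro exI[of _ \<eta>]) simp
  next
    case True
    then have JJ: "J = insert None J'" "None \<notin> J'" unfolding J'_def by auto
    then have card: "R = Suc (card J')" using J(3) J'(1) by simp
    define \<theta> where "\<theta> j = (if j = None then s (R - 1) - (\<Sum>j\<in>J'. \<eta> j * B j ^ (R - 1)) else \<eta> j)" for j
    have mem: "\<eta> j * B j ^ (R - 1) \<in> subfield_ac m" if "j \<in> J'" for j
      unfolding some[OF that, symmetric] using \<eta>(1) that by (intro lift_part_closed[OF \<beta>(2)]) simp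
    have "\<theta> j \<in> subfield_ac m" if "j \<in> J" for j
      using that \<eta>(1) s subfield_ac_sum[of J', OF mem] unfolding \<theta>_def JJ(1) by (auto intro: subfield_ac_closed(3))
    moreover have "(\<Sum>j\<in>J. lift_part \<beta> R j l (\<theta> j)) = s l" if "l < R" for l
    proof -
      have "(\<Sum>j\<in>J'. lift_part \<beta> R j l (\<theta> j)) = (\<Sum>j\<in>J'. \<eta> j * B j ^ l)"
        using JJ(2) some by (intro sum.cong) (auto simp: \<theta>_def)
      then have "(\<Sum>j\<in>J. lift_part \<beta> R j l (\<theta> j)) = lift_part \<beta> R None l (\<theta> None) + (\<Sum>j\<in>J'. \<eta> j * B j ^ l)"
        unfolding JJ(1) using J'(1) JJ(2) by simp
      also have "\<dots> = s l"
      proof (cases "Suc l = R")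
        case True
        then have "l = R - 1" by simp
        then show ?thesis using True by (simp add: lift_part_def \<theta>_def)
      next
        case False
        then have "l < card J'" using that card by simp
        then show ?thesis using False \<eta>(2) by (simp add: lift_part_def)
      qed
      finally show ?thesis .
    qed
    ultimately show ?thesis by (intro exI[of _ \<theta>]) simp
  qed
qed

lemma length_function_lift:
  assumes q: "card (UNIV :: 'a::{field,finite} set) \<ge> 7" and R: "R \<ge> 4" and m: "m > 0"
    and large: "R * card (UNIV :: 'a set) \<le> card (UNIV :: 'a set) ^ m"
  shows "length_function TYPE('a) ((m + 2) * R) R \<le> (R * card (UNIV :: 'a set) + 1) * card (UNIV :: 'a set) ^ m"
proof -
  let ?q = "card (UNIV :: 'a set)" and ?K = "subfield_ac m :: 'a alg_closure set"
  let ?r = "(m + 2) * R"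
  from points_exact[OF q R] obtain f :: "'a \<Rightarrow> 'a" where f:
    "\<forall>u \<tau>. \<exists>J c. J \<subseteq> points R \<and> finite J \<and> card J = R \<and> (\<forall>j\<in>J. c j \<noteq> 0) \<and>
      (\<forall>k<R. (\<Sum>j\<in>J. c j * ucoord j k) = u k \<and> (\<Sum>j\<in>J. c j * tcoord f j k) = \<tau> k)" by (rule exE)
  obtain \<phi> :: "'a alg_closure \<Rightarrow> nat \<Rightarrow> 'a" where \<phi>:
    "\<And>x y i. x \<in> ?K \<Longrightarrow> y \<in> ?K \<Longrightarrow> \<phi> (x + y) i = \<phi> x i + \<phi> y i"
    "\<And>a x i. x \<in> ?K \<Longrightarrow> \<phi> (to_ac a * x) i = a * \<phi> x i"
    "\<And>g. \<exists>x \<in> ?K. \<forall>i<m. \<phi> x i = g i"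
    using subfield_ac_coordinates[OF m] by blast
  have zero: "(0 :: 'a alg_closure) \<in> ?K" using subfield_ac_closed(6)[of "0 :: 'a" m] by simp
  have \<phi>_sum: "\<phi> (\<Sum>j\<in>J. g j) i = (\<Sum>j\<in>J. \<phi> (g j) i)" if "finite J" "\<And>j. j \<in> J \<Longrightarrow> g j \<in> ?K"
    for J :: "'a point set" and g i
    using that
  proof (induction J rule: finite_induct)
    case empty
    then show ?case using \<phi>(2)[OF zero, of 0 i] by simp
  next
    case (insert j J)
    then show ?case using \<phi>(1)[of "g j" "\<Sum>j\<in>J. g j" i] subfield_ac_sum[of J g m] by simp
  qed
  have cardK: "card ?K = ?q ^ m" using card_subfield_ac[OF m] .
  have finK: "finite ?K" using cardK q by (intro card_ge_0_finite) simp
  have "card ({..<R} \<times> (UNIV :: 'a set)) \<le> card ?K" using large cardK by (simp add: card_cartesian_product)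
  then obtain \<beta>0 where \<beta>0: "inj_on \<beta>0 ({..<R} \<times> (UNIV :: 'a set))" "\<beta>0 ` ({..<R} \<times> UNIV) \<subseteq> ?K"
    using card_le_inj[OF _ finK, of "{..<R} \<times> (UNIV :: 'a set)"] by auto
  \<comment> \<open>By \<open>large\<close> the extension field has enough elements for different
    values at all pairs. The value 0 elsewhere keeps the whole range inside it.\<close>
  define \<beta> where "\<beta> p = (if p \<in> {..<R} \<times> UNIV then \<beta>0 p else 0)" for p
  have \<beta>: "inj_on \<beta> ({..<R} \<times> UNIV)" "range \<beta> \<subseteq> ?K"
  proof -
    show "inj_on \<beta> ({..<R} \<times> UNIV)"
      by (subst inj_on_cong[of _ _ \<beta>0]) (use \<beta>0(1) in \<open>simp_all add: \<beta>_def\<close>)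
    show "range \<beta> \<subseteq> ?K" using \<beta>0(2) zero unfolding \<beta>_def by (auto simp: image_subset_iff)
  qed
  \<comment> \<open>The last \<open>R * m\<close> entries form \<open>R\<close> groups of
    \<open>m\<close> coordinates; group \<open>l\<close> holds the element
    \<open>lift_part \<beta> R j l x\<close>.\<close>
  define g :: "'a point \<times> 'a alg_closure \<Rightarrow> 'a vec" where
    "g jx = vec ?r (\<lambda>k. if k < R then ucoord (fst jx) k else if k < 2 * R then tcoord f (fst jx) (k - R)
       else \<phi> (lift_part \<beta> R (fst jx) ((k - 2 * R) div m) (snd jx)) ((k - 2 * R) mod m))" for jx
  have "covers ?r R (g ` (points R \<times> ?K))"
  proof (rule covers_indexed)
    fix v :: "'a vec" assume "v \<in> carrier_vec ?r"
    from f[THEN spec[of _ "\<lambda>k. v $ k"], THEN spec[of _ "\<lambda>k. v $ (R + k)"]] obtain J c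
      where J: "J \<subseteq> points R" "finite J" "card J = R" "\<forall>j\<in>J. c j \<noteq> 0"
        "\<forall>k<R. (\<Sum>j\<in>J. c j * ucoord j k) = v $ k \<and> (\<Sum>j\<in>J. c j * tcoord f j k) = v $ (R + k)"
      by (elim exE conjE)
    have "\<forall>l. \<exists>x\<in>?K. \<forall>i<m. \<phi> x i = v $ (2 * R + l * m + i)"
      using \<phi>(3) by (rule allI)
    then obtain s where s: "\<And>l. s l \<in> ?K" "\<And>l i. i < m \<Longrightarrow> \<phi> (s l) i = v $ (2 * R + l * m + i)" by metis
    have R0: "R > 0" using R by simp
    from lift_solution[OF J(1-3) R0 \<beta>, of s, OF s(1)] obtain \<eta> where \<eta>:
      "\<forall>j\<in>J. \<eta> j \<in> ?K" "\<forall>l<R. (\<Sum>j\<in>J. lift_part \<beta> R j l (\<eta> j)) = s l" by (elim exE conjE)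
    \<comment> \<open>The column over \<open>j\<close> enters with the nonzero coefficient
      \<open>c j\<close>, fixed by the first \<open>2 * R\<close> entries, so its field element is
      the solution divided by \<open>c j\<close>.\<close>
    define \<xi> where "\<xi> j = \<eta> j / to_ac (c j)" for j
    have \<xi>: "\<xi> j \<in> ?K" "to_ac (c j) * \<xi> j = \<eta> j" if "j \<in> J" for j
      using that \<eta>(1) J(4) subfield_ac_closed(5,6)[where ?'a = 'a and m = m] unfolding \<xi>_def by simp_all
    have inj: "inj_on (\<lambda>j. (j, \<xi> j)) J" by (rule inj_onI) simp
    have "v $ i = (\<Sum>j\<in>J. c j * g (j, \<xi> j) $ i)" if i: "i < ?r" for i
    proof -
      consider "i < R" | "R \<le> i" "i < 2 * R" | "2 * R \<le> i" by linarith
      then show ?thesis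
      proof cases
        case 1
        then show ?thesis using J(5)[rule_format, of i] i unfolding g_def by simp
      next
        case 2
        then show ?thesis using J(5)[rule_format, of "i - R"] i unfolding g_def by simp
      next
        case 3
        define l where "l = (i - 2 * R) div m"
        define k where "k = (i - 2 * R) mod m"
        have "i - 2 * R < R * m" using i 3 by (simp add: algebra_simps)
        then have l: "l < R" unfolding l_def by (simp add: less_mult_imp_div_less)
        have k: "k < m" unfolding k_def using m by simp
        have "2 * R + l * m + k = i" unfolding l_def k_def using 3 by simp
        then have "v $ i = \<phi> (s l) k" using s(2)[OF k, of l] by simp
        also have "\<dots> = \<phi> (\<Sum>j\<in>J. lift_part \<beta> R j l (\<eta> j)) k" using \<eta>(2) l by simp
        also have "\<dots> = (\<Sum>j\<in>J. \<phi> (lift_part \<beta> R j l (\<eta> j)) k)"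
          using \<eta>(1) by (intro \<phi>_sum J(2) lift_part_closed[OF \<beta>(2)]) simp
        also have "\<dots> = (\<Sum>j\<in>J. c j * g (j, \<xi> j) $ i)"
        proof (rule sum.cong)
          fix j assume j: "j \<in> J"
          have "\<phi> (lift_part \<beta> R j l (\<eta> j)) k = c j * \<phi> (lift_part \<beta> R j l (\<xi> j)) k"
            unfolding \<xi>(2)[OF j, symmetric] lift_part_mult[symmetric]
            using \<xi>(1)[OF j] by (intro \<phi>(2) lift_part_closed[OF \<beta>(2)])
          then show "\<phi> (lift_part \<beta> R j l (\<eta> j)) k = c j * g (j, \<xi> j) $ i"
            using i 3 unfolding g_def l_def k_def by simp
        qed simp
        finally show ?thesis .
      qed
    qed
    then have "\<forall>i<?r. v $ i = (\<Sum>jx\<in>(\<lambda>j. (j, \<xi> j)) ` J. c (fst jx) * g jx $ i)"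
      by (simp add: sum.reindex[OF inj])
    moreover have "(\<lambda>j. (j, \<xi> j)) ` J \<subseteq> points R \<times> ?K" using J(1) \<xi>(1) by auto
    moreover have "card ((\<lambda>j. (j, \<xi> j)) ` J) \<le> R" using card_image[OF inj] J(3) by simp
    ultimately show "\<exists>J c. J \<subseteq> points R \<times> ?K \<and> finite J \<and> card J \<le> R \<and> (\<forall>i<?r. v $ i = (\<Sum>j\<in>J. c j * g j $ i))"
      using finite_imageI[OF J(2), of "\<lambda>j. (j, \<xi> j)"]
      by (intro exI[of _ "(\<lambda>j. (j, \<xi> j)) ` J"] exI[of _ "\<lambda>jx. c (fst jx)"] conjI)
  qed (simp add: g_def)
  then have "length_function TYPE('a) ?r R \<le> card (g ` (points R \<times> ?K))"
    by (intro length_function_le_covers) (use R in \<open>simp_all add: g_def image_subset_iff\<close>)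
  also have "\<dots> \<le> card ((points R :: 'a point set) \<times> ?K)"
    by (intro card_image_le finite_cartesian_product points_finite(1) finK)
  also have "\<dots> = (R * ?q + 1) * ?q ^ m"
    using points_finite(2)[of R, where ?'a = 'a] cardK by (simp add: card_cartesian_product)
  finally show ?thesis .
qed

section \<open>The numerical bounds\<close>

lemma power_bound_of_log:
  assumes "q \<ge> 7" "R \<ge> 4" and log: "real_of_int \<lceil>log (real q) (real R)\<rceil> + 3 \<le> real t"
  shows "t \<ge> 3" "R * q \<le> q ^ (t - 2)"
proof -
  have "log (real q) (real R) \<ge> 0" using assms(1,2) by simp
  then have "\<lceil>log (real q) (real R)\<rceil> \<ge> 0" by (simp add: ceiling_mono[of 0, simplified])
  then show t: "t \<ge> 3" using log by linarith
  have "log (real q) (real R) \<le> real (t - 3)" using log t by linarith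
  then have "real R \<le> real q powr real (t - 3)" using assms(1,2) by (simp add: log_le_iff)
  also have "\<dots> = real (q ^ (t - 3))" using assms(1) by (simp add: powr_realpow)
  finally have "R \<le> q ^ (t - 3)" by (simp only: of_nat_le_iff)
  then have "R * q \<le> q ^ (t - 3) * q" by simp
  also have "\<dots> = q ^ (t - 2)" 
  proof -
    have "t - 2 = Suc (t - 3)" using t by simp
    then show ?thesis by simp
  qed
  finally show "R * q \<le> q ^ (t - 2)" .
qed

theorem theorem2p1:
  fixes q R t r m\<^sub>1 :: nat
  assumes q: "q = card (UNIV :: 'a::{field,finite} set)"
    and R: "R \<ge> 4"
    and t: "t \<ge> 2"
    and r: "r = t * R"
    and m1: "m\<^sub>1 = nat \<lceil>log (real q) (real (R + 1))\<rceil> + 1"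
  shows "length_function TYPE('a) r R = min_saturating_size TYPE('a) (r - 1) (R - 1) \<and>
    (\<forall>\<Delta> :: real.
       (t = 2 \<and> (q = 4 \<or> q \<ge> 7) \<and> \<Delta> = 0) \<or>
       (t = 2 \<and> q = 5 \<and> R \<in> {4, 5} \<and> \<Delta> = 0) \<or>
       (int t \<ge> \<lceil>log (real q) (real R)\<rceil> + 3 \<and> q \<ge> 7 \<and> odd q \<and> \<Delta> = 0) \<or>
       (m\<^sub>1 + 2 < t \<and> t < 3 * m\<^sub>1 + 2 \<and> q \<ge> 8 \<and> even q \<and>
          \<Delta> = (\<Sum>j = 2..t. real q powr ((real r - real j * real R) / real R))) \<or>
       ((t = m\<^sub>1 + 2 \<or> t \<ge> 3 * m\<^sub>1 + 2) \<and> q \<ge> 8 \<and> even q \<and>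
          \<Delta> = (\<Sum>j = 2..m\<^sub>1 + 2. real q powr ((real r - real j * real R) / real R)))
       \<longrightarrow> real (length_function TYPE('a) r R) \<le>
            real R * real q powr ((real r - real R) / real R)
            + real q powr ((real r - 2 * real R) / real R) + \<Delta>)"
proof -
  let ?l = "length_function TYPE('a) r R"
  let ?bound = "real R * real q powr ((real r - real R) / real R) + real q powr ((real r - 2 * real R) / real R)"
  have q2: "q \<ge> 2" using finite_card_field_ge_2[where ?'a = 'a] q by simp
  have "(real r - real R) / real R = real (t - 1)" "(real r - 2 * real R) / real R = real (t - 2)"
    unfolding r using R t by (simp_all add: of_nat_diff field_simps)
  then have bound: "?bound = real (R * q ^ (t - 1) + q ^ (t - 2))"
    using q2 by (simp add: powr_realpow)
  have two: "real ?l \<le> ?bound" if "t = 2" "q \<ge> 4"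
  proof -
    have "?l \<le> R * q + 1" using length_function_double[of R, where ?'a = 'a] that R q r by simp
    also have "\<dots> = R * q ^ (t - 1) + q ^ (t - 2)" using that by simp
    finally show ?thesis unfolding bound by (rule of_nat_mono)
  qed
  have lift: "real ?l \<le> ?bound" if "q \<ge> 7" "real_of_int \<lceil>log (real q) (real R)\<rceil> + 3 \<le> real t"
  proof -
    note pow = power_bound_of_log[OF that(1) R that(2)]
    have "t - 2 + 2 = t" using t by simp
    then have "(t - 2 + 2) * R = r" unfolding r by (rule arg_cong)
    then have "?l \<le> (R * q + 1) * q ^ (t - 2)"
      using length_function_lift[of R "t - 2", where ?'a = 'a] pow that(1) R q by simp
    also have "\<dots> = R * q ^ (t - 1) + q ^ (t - 2)"
    proof -
      have "t - 1 = Suc (t - 2)" using t by simp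
      then show ?thesis by (simp add: algebra_simps)
    qed
    finally show ?thesis unfolding bound by (rule of_nat_mono)
  qed
  \<comment> \<open>\<open>m\<^sub>1\<close> is defined with \<open>R + 1\<close> instead of
    \<open>R\<close>, so \<open>t \<ge> m\<^sub>1 + 2\<close> implies the condition on
    \<open>t\<close> in \<open>lift\<close>.\<close>
  have large: "real ?l \<le> ?bound" if "q \<ge> 8" "m\<^sub>1 + 2 \<le> t"
  proof (rule lift)
    have "log (real q) (real R) \<le> log (real q) (real (R + 1))" using q2 R by simp
    then have "\<lceil>log (real q) (real R)\<rceil> \<le> \<lceil>log (real q) (real (R + 1))\<rceil>" by (rule ceiling_mono)
    then show "real_of_int \<lceil>log (real q) (real R)\<rceil> + 3 \<le> real t" using that(2) unfolding m1 by linarith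
  qed (use that(1) in simp)
  show ?thesis
  proof (intro conjI allI impI)
    show "length_function TYPE('a) r R = min_saturating_size TYPE('a) (r - 1) (R - 1)"
      by (rule length_function_eq_min_saturating_size) (use R t r in simp_all)
  next
    fix \<Delta> :: real
    assume "(t = 2 \<and> (q = 4 \<or> q \<ge> 7) \<and> \<Delta> = 0) \<or>
       (t = 2 \<and> q = 5 \<and> R \<in> {4, 5} \<and> \<Delta> = 0) \<or>
       (int t \<ge> \<lceil>log (real q) (real R)\<rceil> + 3 \<and> q \<ge> 7 \<and> odd q \<and> \<Delta> = 0) \<or>
       (m\<^sub>1 + 2 < t \<and> t < 3 * m\<^sub>1 + 2 \<and> q \<ge> 8 \<and> even q \<and>
          \<Delta> = (\<Sum>j = 2..t. real q powr ((real r - real j * real R) / real R))) \<or>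
       ((t = m\<^sub>1 + 2 \<or> t \<ge> 3 * m\<^sub>1 + 2) \<and> q \<ge> 8 \<and> even q \<and>
          \<Delta> = (\<Sum>j = 2..m\<^sub>1 + 2. real q powr ((real r - real j * real R) / real R)))"
    moreover define S where "S n = (\<Sum>j = 2..n. real q powr ((real r - real j * real R) / real R))" for n :: nat
    \<comment> \<open>The correction terms are nonnegative, so each case follows from the bound
      without them.\<close>
    moreover have "S n \<ge> 0" for n unfolding S_def by (rule sum_nonneg) simp
    ultimately consider "t = 2" "q \<ge> 4" "\<Delta> \<ge> 0"
      | "\<lceil>log (real q) (real R)\<rceil> + 3 \<le> int t" "q \<ge> 7" "\<Delta> \<ge> 0" | "q \<ge> 8" "m\<^sub>1 + 2 \<le> t" "\<Delta> \<ge> 0"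
      unfolding S_def[symmetric] by fastforce
    then have "real ?l \<le> ?bound \<and> \<Delta> \<ge> 0"
    proof cases
      case 1
      then show ?thesis using two by blast
    next
      case 2
      have "real_of_int \<lceil>log (real q) (real R)\<rceil> + 3 \<le> real t" using 2(1) by linarith
      then show ?thesis using lift 2 by blast
    next
      case 3
      then show ?thesis using large by blast
    qed
    then show "real ?l \<le> ?bound + \<Delta>" by linarith
  qed
qed

end
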